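(* Suppose $\sum_{i=1}^nh_i(u)^2\,du_i^2$ is a flat Egoroff metric, $\beta$ its rotation coefficient matrix, $h=(h_1,\dots,h_n)^t$, and $X$ the associated family of flat Lagrangian immersions in $\mathbb{C}^n$ with non-degenerate normal bundle. Let $\alpha\in\mathbb{R}\setminus\{0\}$, let $\pi$ be a Hermitian projection of $\mathbb{C}^n$ with $\bar\pi=\pi$, and let $b\in\mathbb{R}^n$. Then the following system is solvable for $\tilde\pi$ and $y$: $$\begin{cases}d\tilde\pi=[[\delta,\beta],\tilde\pi]+\alpha[\delta,\tilde\pi](\mathrm{I}-2\tilde\pi),&\tilde\pi(0)=\pi,\\ dy=-[\delta,\beta-2\alpha\tilde\pi]\,y+\tilde\pi\,\delta h-\alpha\,\delta y,&y(0)=b,\end{cases}$$ where $\tilde\pi^2=\tilde\pi$, $\tilde\pi^*=\tilde\pi=\overline{\tilde\pi}$, and $y(u)\in\mathbb{R}^n$. Moreover, set $\tilde h=h-2\alpha y$; then $d\tilde s^2=\sum_{j=1}^n\tilde h_j^2\,du_j^2$ is again a flat Egoroff metric and $\tilde\beta=\beta-2\alpha\tilde\pi_\ast$ is the rotation coefficient matrix for $d\tilde s^2$.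
   Context: $u=(u_1,\dots,u_n)$ ranges over a simply connected domain in $\mathbb{R}^n$ containing $0$. $\delta=\mathrm{diag}(du_1,\dots,du_n)$, $[A,B]=AB-BA$. For a matrix $\xi$, $\xi_\ast$ is $\xi$ with its diagonal entries replaced by $0$. A Hermitian projection is a matrix $\pi$ with $\pi^2=\pi=\pi^*$; a bar denotes entrywise complex conjugation. A flat Egoroff metric is a flat metric $\sum_i h_i^2\,du_i^2$ for which there is a potential function $\phi$ with $\partial\phi/\partial u_i=h_i^2$ for all $i$. Its rotation coefficient matrix is $\beta=(\beta_{ij})$ with $\beta_{ij}=(h_i)_{u_j}/h_j$ for $i\ne j$ and $\beta_{ii}=0$ (it is symmetric). The associated family $X(u,\lambda)$ is defined by the unique $F(u,\lambda)=\begin{pmatrix}E&X\\0&1\end{pmatrix}$ with $F^{-1}dF=\begin{pmatrix}\mathrm{i}\lambda\delta+[\delta,\beta]&\delta h\\0&0\end{pmatrix}$ and $F(0,\lambda)=\mathrm{I}$; for $\lambda\in\mathbb{R}\setminus\{0\}$, $X(\cdot,\lambda)$ is a Lagrangian immersion in $\mathbb{C}^n=\mathbb{R}^{2n}$ (the symplectic form $\mathrm{Im}(\bar Z_1^tZ_2)$ pulls back to $0$) with induced flat metric $\sum_ih_i^2du_i^2$. Its normal bundle is non-degenerate if at each point the space of shape operators has dimension equal to the codimension.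
   Formalization: The right side of the equation for dπ̃ has the opposite overall sign (as printed the system can be unsolvable, e.g. n=2, h=(1,1), β=0, α=1, b=0, all entries of π equal 1/2), and the new metric is asserted only on the open set where every h̃_j is nonzero. *)

theory Defs
  imports "HOL-Analysis.Analysis"
begin

section \<open>Smooth maps on open subsets of \<open>\<real>\<^sup>n\<close>\<close>

definition partial :: "'n::finite \<Rightarrow> (real^'n \<Rightarrow> 'b::real_normed_vector) \<Rightarrow> real^'n \<Rightarrow> 'b" where
  "partial i f u = frechet_derivative f (at u) (axis i 1)"

text \<open>\<open>Ck_on k U f\<close>: \<open>f\<close> is of class \<open>C\<^sup>k\<close> on \<open>U\<close>.  It is only used for open \<open>U\<close>, where
  \<^const>\<open>differentiable_on\<close> is differentiability at each point.\<close>

primrec Ck_on :: "nat \<Rightarrow> (real^'n) set \<Rightarrow> (real^'n \<Rightarrow> 'b::real_normed_vector) \<Rightarrow> bool" where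
  "Ck_on 0 U f \<longleftrightarrow> continuous_on U f"
| "Ck_on (Suc k) U f \<longleftrightarrow> f differentiable_on U \<and> (\<forall>i. Ck_on k U (partial i f))"

definition smooth_on :: "(real^'n) set \<Rightarrow> (real^'n \<Rightarrow> 'b::real_normed_vector) \<Rightarrow> bool" where
  "smooth_on U f \<longleftrightarrow> (\<forall>k. Ck_on k U f)"

section \<open>Flat metrics\<close>

text \<open>A metric is given by its matrix \<open>g\<close> of coefficients \<open>g\<^sub>i\<^sub>j\<close> in the coordinates \<open>u\<close>;
  \<open>christoffel g k i j\<close> is the symbol with upper index \<open>k\<close>, and \<open>riemann g l k i j\<close> is the
  \<open>l\<close>-th component of \<open>R(\<partial>\<^sub>i, \<partial>\<^sub>j) \<partial>\<^sub>k\<close>.\<close>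

definition christoffel ::
    "(real^'n \<Rightarrow> real^'n^'n) \<Rightarrow> 'n \<Rightarrow> 'n \<Rightarrow> 'n \<Rightarrow> real^'n \<Rightarrow> real" where
  "christoffel g k i j u = (1/2) * (\<Sum>l\<in>UNIV. matrix_inv (g u) $ k $ l *
     (partial i (\<lambda>x. g x $ j $ l) u + partial j (\<lambda>x. g x $ i $ l) u
      - partial l (\<lambda>x. g x $ i $ j) u))"

definition riemann ::
    "(real^'n \<Rightarrow> real^'n^'n) \<Rightarrow> 'n \<Rightarrow> 'n \<Rightarrow> 'n \<Rightarrow> 'n \<Rightarrow> real^'n \<Rightarrow> real" where
  "riemann g l k i j u =
     partial i (christoffel g l j k) u - partial j (christoffel g l i k) u
     + (\<Sum>m\<in>UNIV. christoffel g l i m u * christoffel g m j k u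
                  - christoffel g l j m u * christoffel g m i k u)"

definition flat_metric_on :: "(real^'n) set \<Rightarrow> (real^'n \<Rightarrow> real^'n^'n) \<Rightarrow> bool" where
  "flat_metric_on U g \<longleftrightarrow> smooth_on U g
     \<and> (\<forall>u\<in>U. transpose (g u) = g u \<and> (\<forall>v. v \<noteq> 0 \<longrightarrow> v \<bullet> (g u *v v) > 0))
     \<and> (\<forall>u\<in>U. \<forall>l k i j. riemann g l k i j u = 0)"

section \<open>Flat Egoroff metrics\<close>

definition diag_mat :: "'a::zero^'n \<Rightarrow> 'a^'n^'n" where
  "diag_mat v = (\<chi> i j. if i = j then v $ i else 0)"

definition diag_metric :: "(real^'n \<Rightarrow> real^'n) \<Rightarrow> real^'n \<Rightarrow> real^'n^'n" where
  "diag_metric h u = diag_mat (\<chi> i. (h u $ i)\<^sup>2)"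

definition egoroff_potential_on ::
    "(real^'n) set \<Rightarrow> (real^'n \<Rightarrow> real^'n) \<Rightarrow> (real^'n \<Rightarrow> real) \<Rightarrow> bool" where
  "egoroff_potential_on U h \<phi> \<longleftrightarrow>
     smooth_on U \<phi> \<and> (\<forall>u\<in>U. \<forall>i. partial i \<phi> u = (h u $ i)\<^sup>2)"

definition flat_egoroff_on :: "(real^'n) set \<Rightarrow> (real^'n \<Rightarrow> real^'n) \<Rightarrow> bool" where
  "flat_egoroff_on U h \<longleftrightarrow> smooth_on U h
     \<and> (\<forall>u\<in>U. \<forall>i. h u $ i \<noteq> 0)
     \<and> flat_metric_on U (diag_metric h)
     \<and> (\<exists>\<phi>. egoroff_potential_on U h \<phi>)"

definition rotation_coeffs :: "(real^'n \<Rightarrow> real^'n) \<Rightarrow> real^'n \<Rightarrow> real^'n^'n" where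
  "rotation_coeffs h u =
     (\<chi> i j. if i = j then 0 else partial j (\<lambda>x. h x $ i) u / (h u $ j))"

section \<open>Complex matrices and matrix valued 1-forms\<close>

definition cvec :: "real^'n \<Rightarrow> complex^'n" where
  "cvec v = (\<chi> i. complex_of_real (v $ i))"

definition cmat :: "real^'n^'n \<Rightarrow> complex^'n^'n" where
  "cmat A = map_matrix complex_of_real A"

definition commutator :: "complex^'n^'n \<Rightarrow> complex^'n^'n \<Rightarrow> complex^'n^'n" where
  "commutator A B = A ** B - B ** A"

definition offdiag :: "complex^'n^'n \<Rightarrow> complex^'n^'n" where
  "offdiag A = (\<chi> i j. if i = j then 0 else A $ i $ j)"

definition hermitian_projection :: "complex^'n^'n \<Rightarrow> bool" where
  "hermitian_projection P \<longleftrightarrow> P ** P = P \<and> transpose (map_matrix cnj P) = P"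

text \<open>A 1-form is a function of the tangent vector \<open>v\<close>; \<open>\<delta> = diag(du\<^sub>1, \<dots>, du\<^sub>n)\<close> evaluated
  on \<open>v\<close> is the diagonal matrix of \<open>v\<close>, and an equation \<open>df = \<theta>\<close> says that the Frechet
  derivative of \<open>f\<close> is the linear map \<open>v \<mapsto> \<theta>(v)\<close>.\<close>

definition delta :: "real^'n \<Rightarrow> complex^'n^'n" where
  "delta v = diag_mat (cvec v)"

section \<open>The associated family\<close>

text \<open>The bordered matrices with blocks \<open>A\<close>, \<open>x\<close> and last row \<open>(0, c)\<close>; the index
  \<^const>\<open>None\<close> is the additional row and column.\<close>

definition bordered :: "complex^'n^'n \<Rightarrow> complex^'n \<Rightarrow> complex \<Rightarrow> complex^('n option)^('n option)" where
  "bordered A x c = (\<chi> r s. case r of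
      None \<Rightarrow> (case s of None \<Rightarrow> c | Some j \<Rightarrow> 0)
    | Some i \<Rightarrow> (case s of None \<Rightarrow> x $ i | Some j \<Rightarrow> A $ i $ j))"

definition lax_form ::
    "(real^'n \<Rightarrow> real^'n) \<Rightarrow> (real^'n \<Rightarrow> real^'n^'n) \<Rightarrow> complex \<Rightarrow> real^'n \<Rightarrow> real^'n
     \<Rightarrow> complex^('n option)^('n option)" where
  "lax_form h \<beta> l u v =
     bordered (mat (\<i> * l) ** delta v + commutator (delta v) (cmat (\<beta> u)))
       (delta v *v cvec (h u)) 0"

text \<open>\<open>F\<inverse> dF = \<theta>\<close> is written as \<open>F\<close> invertible with \<open>dF = F \<theta>\<close>.  The spectral parameter
  is complex: the frame exists and is unique for every complex value.\<close>

definition associated_family ::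
    "(real^'n) set \<Rightarrow> (real^'n \<Rightarrow> real^'n) \<Rightarrow> (real^'n \<Rightarrow> real^'n^'n)
     \<Rightarrow> (complex \<Rightarrow> real^'n \<Rightarrow> complex^'n) \<Rightarrow> bool" where
  "associated_family U h \<beta> X \<longleftrightarrow>
     (\<exists>E :: complex \<Rightarrow> real^'n \<Rightarrow> complex^'n^'n. \<forall>l.
        bordered (E l 0) (X l 0) 1 = mat 1
      \<and> (\<forall>u\<in>U. invertible (bordered (E l u) (X l u) 1)
           \<and> ((\<lambda>x. bordered (E l x) (X l x) 1) has_derivative
               (\<lambda>v. bordered (E l u) (X l u) 1 ** lax_form h \<beta> l u v)) (at u)))"

section \<open>Lagrangian immersions and their normal bundle\<close>

text \<open>The inner product of \<^typ>\<open>complex^'n\<close> is the Euclidean one of \<open>\<real>\<^sup>2\<^sup>n\<close>.\<close>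

definition immersion_on :: "(real^'n) set \<Rightarrow> (real^'n \<Rightarrow> 'b::real_normed_vector) \<Rightarrow> bool" where
  "immersion_on U f \<longleftrightarrow> smooth_on U f \<and> (\<forall>u\<in>U. inj (frechet_derivative f (at u)))"

definition induced_metric :: "(real^'n \<Rightarrow> 'b::real_inner) \<Rightarrow> real^'n \<Rightarrow> real^'n^'n" where
  "induced_metric f u = (\<chi> i j. partial i f u \<bullet> partial j f u)"

definition symplectic :: "complex^'n \<Rightarrow> complex^'n \<Rightarrow> real" where
  "symplectic z w = Im (\<Sum>i\<in>UNIV. cnj (z $ i) * w $ i)"

definition lagrangian_immersion_on :: "(real^'n) set \<Rightarrow> (real^'n \<Rightarrow> complex^'n) \<Rightarrow> bool" where
  "lagrangian_immersion_on U f \<longleftrightarrow> immersion_on U f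
     \<and> (\<forall>u\<in>U. \<forall>v w. symplectic (frechet_derivative f (at u) v) (frechet_derivative f (at u) w) = 0)"

definition normal_space :: "(real^'n \<Rightarrow> 'b::euclidean_space) \<Rightarrow> real^'n \<Rightarrow> 'b set" where
  "normal_space f u = {\<nu>. \<forall>v. \<nu> \<bullet> frechet_derivative f (at u) v = 0}"

definition second_derivative ::
    "(real^'n \<Rightarrow> 'b::euclidean_space) \<Rightarrow> real^'n \<Rightarrow> real^'n \<Rightarrow> real^'n \<Rightarrow> 'b" where
  "second_derivative f u v w = frechet_derivative (\<lambda>x. frechet_derivative f (at x) w) (at u) v"

text \<open>The shape operator in the normal direction \<open>\<nu>\<close> is the endomorphism \<open>S\<close> of the tangent
  space, written as a matrix in the coordinates \<open>u\<close>, with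
  \<open>\<langle>S v, w\<rangle> = \<langle>\<nu>, II(v, w)\<rangle>\<close>; the tangential part of the second derivative does not
  contribute to the right hand side.\<close>

definition shape_operators :: "(real^'n \<Rightarrow> 'b::euclidean_space) \<Rightarrow> real^'n \<Rightarrow> (real^'n^'n) set" where
  "shape_operators f u = {S. \<exists>\<nu>\<in>normal_space f u. \<forall>v w.
     frechet_derivative f (at u) (S *v v) \<bullet> frechet_derivative f (at u) w
       = \<nu> \<bullet> second_derivative f u v w}"

definition nondegenerate_normal_bundle_on ::
    "(real^'n) set \<Rightarrow> (real^'n \<Rightarrow> 'b::euclidean_space) \<Rightarrow> bool" where
  "nondegenerate_normal_bundle_on U f \<longleftrightarrow>
     (\<forall>u\<in>U. dim (shape_operators f u) = DIM('b) - CARD('n))"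

section \<open>The transformation\<close>

text \<open>With \<open>\<beta>\<^sub>i\<^sub>j = (h\<^sub>i)\<^sub>u\<^sub>j / h\<^sub>j\<close>, the form \<open>\<omega> = [\<delta>, \<beta>]\<close> satisfies
  \<open>d\<omega> + \<omega> \<and> \<omega> = 0\<close>, and the system for \<open>y\<close> is then integrable along solutions of
  \<open>dP = - ([\<omega>, P] + \<alpha> [\<delta>, P] (I - 2 P)) = [P, \<omega>] + \<alpha> [P, \<delta>] (I - 2 P)\<close>.
  This fixes the overall sign of the equation for \<open>P\<close>: with the opposite sign the
  system for \<open>y\<close> has no solution in general, already for \<open>n = 2\<close>, \<open>h = (1, 1)\<close>,
  \<open>\<beta> = 0\<close>, \<open>\<alpha> = 1\<close>, \<open>b = 0\<close> and all entries of the initial projection equal to \<open>1/2\<close>.\<close>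

definition transformation_system ::
    "(real^'n) set \<Rightarrow> (real^'n \<Rightarrow> real^'n) \<Rightarrow> (real^'n \<Rightarrow> real^'n^'n) \<Rightarrow> real
     \<Rightarrow> complex^'n^'n \<Rightarrow> real^'n \<Rightarrow> (real^'n \<Rightarrow> complex^'n^'n) \<Rightarrow> (real^'n \<Rightarrow> real^'n) \<Rightarrow> bool" where
  "transformation_system U h \<beta> \<alpha> \<pi>0 b P y \<longleftrightarrow>
     (\<forall>u\<in>U. (P has_derivative (\<lambda>v.
          - (commutator (commutator (delta v) (cmat (\<beta> u))) (P u)
             + \<alpha> *\<^sub>R (commutator (delta v) (P u) ** (mat 1 - 2 *\<^sub>R P u))))) (at u))
   \<and> P 0 = \<pi>0
   \<and> (\<forall>u\<in>U. ((\<lambda>x. cvec (y x)) has_derivative (\<lambda>v.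
          - (commutator (delta v) (cmat (\<beta> u) - (2 * \<alpha>) *\<^sub>R P u) *v cvec (y u))
          + P u *v (delta v *v cvec (h u))
          - \<alpha> *\<^sub>R (delta v *v cvec (y u)))) (at u))
   \<and> y 0 = b
   \<and> (\<forall>u\<in>U. hermitian_projection (P u) \<and> map_matrix cnj (P u) = P u)"

end

theory Submission
  imports Defs
begin

text \<open>The transformation is a dressing by a factor with a single pole, and every ingredient can be
  written in terms of the associated family at imaginary values of the spectral parameter.  For
  \<open>\<lambda> = - \<i> s\<close> the connection form of the family becomes the real form \<open>s \<delta> + [\<delta>, \<beta>]\<close>; let \<open>G s\<close> and
  \<open>x s\<close> be the real parts of its frame and position vector.  Below, \<open>a\<close> stands for \<open>\<alpha>\<close>, and \<open>Q\<close> with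
  initial value \<open>\<pi>0\<close> for the projection, which has real entries.  The existence of a potential makes
  \<open>\<beta>\<close> symmetric, so \<open>[\<delta>, \<beta>]\<close> is skew-symmetric and \<open>G (s) G (- s)\<^sup>t = I\<close>.

  Solvability (\<open>real_system_solvable\<close>).  The equation for the projection is a Riccati form of two
  linear equations, one for its image and one for its kernel, and these are solved by \<open>G (a)\<^sup>t\<close> and
  \<open>G (- a)\<^sup>t\<close>.  The equation for \<open>y\<close> is linear.  Its solution is explicit in terms of \<open>G\<close>, \<open>x\<close> and
  the derivative of \<open>G\<close> with respect to \<open>s\<close>, which is obtained in \<open>spectral_derivative\<close> as a limit
  of difference quotients.  In this way the integrability of the system is inherited from that of
  the associated family.

  The new metric.  Writing \<open>h' = h - 2 a y\<close> and \<open>\<beta>' = \<beta> - 2 a Q\<close>, the off-diagonal entries of the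
  equation for \<open>y\<close> give \<open>\<partial>\<^sub>j h'\<^sub>i = \<beta>'\<^sub>i\<^sub>j h'\<^sub>j\<close> at once.  The potential is
  \<open>\<phi> - 4 a (\<bar>y\<bar>\<^sup>2 / 2 + x (- a) \<bullet> (b - \<pi>0 b))\<close> (\<open>potential'\<close>).  For flatness, the frame
  \<open>G (0) (I - 2 Q)\<close> is orthogonal with connection form \<open>[\<delta>, \<beta>']\<close>; its columns, scaled by \<open>h'\<close>, behave
  like the coordinate vector fields of a map into Euclidean space with induced metric
  \<open>\<Sum> h'\<^sub>i\<^sup>2 du\<^sub>i\<^sup>2\<close>, and such a metric has no curvature (\<open>riemann_eq_0_of_closed_frame\<close>).\<close>

section \<open>Partial derivatives and the classes \<open>C\<^sup>k\<close>\<close>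

lemma partial_eqI:
  assumes "(f has_derivative f') (at u)"
  shows "partial i f u = f' (axis i 1)"
  using frechet_derivative_at[OF assms] by (simp add: partial_def)

lemma partial_fun: "partial i f = (\<lambda>u. frechet_derivative f (at u) (axis i 1))"
  by (simp add: partial_def fun_eq_iff)

lemma partial_cong_open:
  assumes "open U" "u \<in> U" "\<And>x. x \<in> U \<Longrightarrow> f x = g x"
  shows "partial i f u = partial i g u"
proof -
  have "(f has_derivative D) (at u) \<longleftrightarrow> (g has_derivative D) (at u)" for D
    using has_derivative_transform_within_open[OF _ assms(1,2)] assms(3) by metis
  then show ?thesis
    by (simp add: partial_def frechet_derivative_def)
qed

lemma Ck_on_cong:
  assumes "open U" "\<And>x. x \<in> U \<Longrightarrow> f x = g x"
  shows "Ck_on k U f \<longleftrightarrow> Ck_on k U g"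
  using assms(2)
proof (induction k arbitrary: f g)
  case 0
  then show ?case by (auto cong: continuous_on_cong)
next
  case (Suc k)
  have "f differentiable_on U \<longleftrightarrow> g differentiable_on U"
    using differentiable_transform_within[OF _ zero_less_one, of _ _ U] Suc.prems
    unfolding differentiable_on_def by metis
  moreover have "Ck_on k U (partial i f) \<longleftrightarrow> Ck_on k U (partial i g)" for i
    by (rule Suc.IH) (use partial_cong_open[OF assms(1)] Suc.prems in blast)
  ultimately show ?case by simp
qed

text \<open>The form in which smoothness of solutions of total differential equations is obtained:
  if the right hand side of \<open>df = f'\<close> is of class \<open>C\<^sup>k\<close> then \<open>f\<close> gains one derivative.\<close>

lemma Ck_on_SucI:
  assumes "open U" "\<And>u. u \<in> U \<Longrightarrow> (f has_derivative f' u) (at u)"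
    and "\<And>i. Ck_on k U (\<lambda>u. f' u (axis i 1))"
  shows "Ck_on (Suc k) U f"
proof -
  have "Ck_on k U (partial i f)" for i
    using assms(3)[of i] Ck_on_cong[OF assms(1), of "partial i f" "\<lambda>u. f' u (axis i 1)"]
      partial_eqI[OF assms(2)] by blast
  moreover have "f differentiable_on U"
    unfolding differentiable_on_def differentiable_def
    using assms(2) has_derivative_at_withinI by blast
  ultimately show ?thesis by simp
qed

lemma Ck_on_has_derivative:
  assumes "open U" "Ck_on (Suc k) U f" "u \<in> U"
  shows "(f has_derivative frechet_derivative f (at u)) (at u)"
  using assms by (simp add: differentiable_on_eq_differentiable_at frechet_derivative_works)

lemma Ck_on_Suc_imp: "Ck_on (Suc k) U f \<Longrightarrow> Ck_on k U f"
proof (induction k arbitrary: f)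
  case 0
  then show ?case by (simp add: differentiable_imp_continuous_on)
next
  case (Suc k)
  then show ?case by (metis Ck_on.simps(2))
qed

lemma smooth_on_has_derivative:
  assumes "open U" "smooth_on U f" "u \<in> U"
  shows "(f has_derivative frechet_derivative f (at u)) (at u)"
  using assms Ck_on_has_derivative[of U 0 f u] by (auto simp: smooth_on_def simp del: Ck_on.simps)

lemma smooth_on_partial: "smooth_on U f \<Longrightarrow> smooth_on U (partial i f)"
  unfolding smooth_on_def by (metis Ck_on.simps(2))

lemma smooth_onI:
  assumes "open U" "\<And>u. u \<in> U \<Longrightarrow> (f has_derivative f' u) (at u)"
    and "\<And>i. smooth_on U (\<lambda>u. f' u (axis i 1))"
  shows "smooth_on U f"
  using Ck_on_SucI[OF assms(1,2)] assms(3) Ck_on_Suc_imp unfolding smooth_on_def by blast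

lemma smooth_on_cong:
  assumes "open U" "\<And>x. x \<in> U \<Longrightarrow> f x = g x"
  shows "smooth_on U f \<longleftrightarrow> smooth_on U g"
  using Ck_on_cong[OF assms] by (simp add: smooth_on_def)

lemma Ck_on_subset:
  assumes "Ck_on k U f" "V \<subseteq> U"
  shows "Ck_on k V f"
  using assms(1)
proof (induction k arbitrary: f)
  case 0
  then show ?case using assms(2) by (auto intro: continuous_on_subset)
next
  case (Suc k)
  then show ?case using assms(2) differentiable_on_subset by auto
qed

lemma Ck_on_const: "Ck_on k U (\<lambda>x::real^'n. c)"
proof (induction k arbitrary: c)
  case (Suc k)
  have "partial i (\<lambda>x::real^'n. c) = (\<lambda>u. 0)" for i
    by (simp add: partial_def fun_eq_iff)
  then show ?case using Suc by simp
qed simp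

lemma Ck_on_bounded_linear:
  assumes "bounded_linear L" "open U" "Ck_on k U f"
  shows "Ck_on k U (\<lambda>x. L (f x))"
  using assms(3)
proof (induction k arbitrary: f)
  case 0
  then show ?case by (simp add: bounded_linear.continuous_on[OF assms(1)])
next
  case (Suc k)
  note d = Ck_on_has_derivative[OF assms(2) Suc.prems]
  show ?case
  proof (rule Ck_on_SucI[OF assms(2)])
    show "((\<lambda>x. L (f x)) has_derivative (\<lambda>v. L (frechet_derivative f (at u) v))) (at u)"
      if "u \<in> U" for u
      using bounded_linear.has_derivative[OF assms(1) d[OF that]] .
    show "Ck_on k U (\<lambda>u. L (frechet_derivative f (at u) (axis i 1)))" for i
      using Suc.IH[of "partial i f"] Suc.prems by (simp add: partial_fun)
  qed
qed

lemma Ck_on_add: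
  assumes "open U" "Ck_on k U f" "Ck_on k U g"
  shows "Ck_on k U (\<lambda>x. f x + g x)"
  using assms(2,3)
proof (induction k arbitrary: f g)
  case 0
  then show ?case by (simp add: continuous_on_add)
next
  case (Suc k)
  show ?case
  proof (rule Ck_on_SucI[OF assms(1)])
    show "((\<lambda>x. f x + g x) has_derivative
        (\<lambda>v. frechet_derivative f (at u) v + frechet_derivative g (at u) v)) (at u)" if "u \<in> U" for u
      using has_derivative_add[OF Ck_on_has_derivative[OF assms(1) Suc.prems(1) that]
        Ck_on_has_derivative[OF assms(1) Suc.prems(2) that]] .
    show "Ck_on k U (\<lambda>u. frechet_derivative f (at u) (axis i 1)
        + frechet_derivative g (at u) (axis i 1))" for i
      using Suc.IH[of "partial i f" "partial i g"] Suc.prems by (simp add: partial_fun)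
  qed
qed

lemma Ck_on_bilinear:
  assumes "bounded_bilinear B" "open U" "Ck_on k U f" "Ck_on k U g"
  shows "Ck_on k U (\<lambda>x. B (f x) (g x))"
  using assms(3,4)
proof (induction k arbitrary: f g)
  case 0
  then show ?case by (simp add: bounded_bilinear.continuous_on[OF assms(1)])
next
  case (Suc k)
  show ?case
  proof (rule Ck_on_SucI[OF assms(2)])
    show "((\<lambda>x. B (f x) (g x)) has_derivative
        (\<lambda>v. B (f u) (frechet_derivative g (at u) v) + B (frechet_derivative f (at u) v) (g u))) (at u)"
      if "u \<in> U" for u
      using bounded_bilinear.FDERIV[OF assms(1) Ck_on_has_derivative[OF assms(2) Suc.prems(1) that]
        Ck_on_has_derivative[OF assms(2) Suc.prems(2) that]] .
    show "Ck_on k U (\<lambda>u. B (f u) (frechet_derivative g (at u) (axis i 1))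
        + B (frechet_derivative f (at u) (axis i 1)) (g u))" for i
      using Ck_on_add[OF assms(2) Suc.IH[of f "partial i g"] Suc.IH[of "partial i f" g]]
        Suc.prems Ck_on_Suc_imp[OF Suc.prems(1)] Ck_on_Suc_imp[OF Suc.prems(2)]
      by (simp add: partial_fun)
  qed
qed

lemma Ck_on_inverse:
  fixes f :: "real^'n \<Rightarrow> real"
  assumes "open U" "Ck_on k U f" "\<And>u. u \<in> U \<Longrightarrow> f u \<noteq> 0"
  shows "Ck_on k U (\<lambda>x. inverse (f x))"
  using assms(2)
proof (induction k)
  case 0
  then show ?case using assms(3) by (simp add: continuous_on_inverse)
next
  case (Suc k)
  note inv = Suc.IH[OF Ck_on_Suc_imp[OF Suc.prems]]
  have mul: "Ck_on k U (\<lambda>x. p x * q x)" if "Ck_on k U p" "Ck_on k U q" for p q :: "real^'n \<Rightarrow> real"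
    by (rule Ck_on_bilinear[OF bounded_bilinear_mult assms(1) that])
  show ?case
  proof (rule Ck_on_SucI[OF assms(1)])
    show "((\<lambda>x. inverse (f x)) has_derivative
        (\<lambda>v. - (inverse (f u) * frechet_derivative f (at u) v * inverse (f u)))) (at u)"
      if "u \<in> U" for u
      using Deriv.has_derivative_inverse[OF assms(3)[OF that] Ck_on_has_derivative[OF assms(1) Suc.prems that]] .
    have "Ck_on k U (\<lambda>u. - (inverse (f u) * partial i f u * inverse (f u)))" for i
      using Suc.prems
      by (intro Ck_on_bounded_linear[OF bounded_linear_minus[OF bounded_linear_ident] assms(1)] mul inv) simp
    then show "Ck_on k U (\<lambda>u. - (inverse (f u) * frechet_derivative f (at u) (axis i 1) * inverse (f u)))"
      for i by (simp add: partial_def)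
  qed
qed

lemma Ck_on_sum:
  assumes "open U" "finite I" "\<And>i. i \<in> I \<Longrightarrow> Ck_on k U (f i)"
  shows "Ck_on k U (\<lambda>x. \<Sum>i\<in>I. f i x)"
  using assms(2,3) by (induction I rule: finite_induct) (auto intro: Ck_on_const Ck_on_add assms(1))

lemma bounded_linear_axis: "bounded_linear (\<lambda>c::'b::real_normed_vector. axis i c :: 'b^'m)"
proof (rule bounded_linear_intro[where K=1])
  fix c :: 'b
  have "norm (axis i c :: 'b^'m) \<le> (\<Sum>j\<in>UNIV. norm ((axis i c :: 'b^'m) $ j))"
    unfolding norm_vec_def by (rule L2_set_le_sum) simp
  also have "\<dots> = (\<Sum>j\<in>UNIV. if j = i then norm c else 0)"
    by (intro sum.cong) (auto simp: axis_def)
  finally show "norm (axis i c :: 'b^'m) \<le> norm c * 1" by simp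
qed (auto simp: vec_eq_iff axis_def)

lemma Ck_on_vec:
  assumes "open U" "\<And>i. Ck_on k U (\<lambda>x. f x $ i)"
  shows "Ck_on k U (f :: _ \<Rightarrow> 'b::real_normed_vector^'m)"
proof -
  have "Ck_on k U (\<lambda>x. axis i (f x $ i))" for i
    by (rule Ck_on_bounded_linear[OF bounded_linear_axis assms])
  then have "Ck_on k U (\<lambda>x. \<Sum>i\<in>UNIV. axis i (f x $ i))"
    by (rule Ck_on_sum[OF assms(1) finite])
  moreover have "(\<Sum>i\<in>UNIV. axis i (w $ i)) = w" for w :: "'b^'m"
    by (auto simp: vec_eq_iff axis_def)
  ultimately show ?thesis by simp
qed

lemma has_derivative_vec:
  assumes "\<And>i. ((\<lambda>x. f x $ i) has_derivative (\<lambda>v. f' v $ i)) (at u)"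
  shows "((f :: 'a::real_normed_vector \<Rightarrow> 'b::real_normed_vector^'m) has_derivative f') (at u)"
proof -
  have "((\<lambda>x. \<Sum>i\<in>UNIV. axis i (f x $ i)) has_derivative (\<lambda>v. \<Sum>i\<in>UNIV. axis i (f' v $ i))) (at u)"
    by (intro has_derivative_sum bounded_linear.has_derivative[OF bounded_linear_axis] assms)
  moreover have "(\<Sum>i\<in>UNIV. axis i (w $ i)) = w" for w :: "'b^'m"
    by (auto simp: vec_eq_iff axis_def)
  ultimately show ?thesis by simp
qed

lemmas smooth_on_const = Ck_on_const[THEN smooth_on_def[THEN iffD2, OF allI]]

lemma smooth_on_subset: "smooth_on U f \<Longrightarrow> V \<subseteq> U \<Longrightarrow> smooth_on V f"
  using Ck_on_subset unfolding smooth_on_def by blast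

lemma smooth_on_bounded_linear:
  "bounded_linear L \<Longrightarrow> open U \<Longrightarrow> smooth_on U f \<Longrightarrow> smooth_on U (\<lambda>x. L (f x))"
  unfolding smooth_on_def using Ck_on_bounded_linear by blast

lemma smooth_on_bilinear:
  "bounded_bilinear B \<Longrightarrow> open U \<Longrightarrow> smooth_on U f \<Longrightarrow> smooth_on U g \<Longrightarrow> smooth_on U (\<lambda>x. B (f x) (g x))"
  unfolding smooth_on_def using Ck_on_bilinear by blast

lemma smooth_on_inverse:
  fixes f :: "real^'n \<Rightarrow> real"
  shows "open U \<Longrightarrow> smooth_on U f \<Longrightarrow> (\<And>u. u \<in> U \<Longrightarrow> f u \<noteq> 0) \<Longrightarrow> smooth_on U (\<lambda>x. inverse (f x))"
  unfolding smooth_on_def using Ck_on_inverse by blast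

lemma smooth_on_vec:
  "open U \<Longrightarrow> (\<And>i. smooth_on U (\<lambda>x. f x $ i)) \<Longrightarrow> smooth_on U f"
  unfolding smooth_on_def using Ck_on_vec by blast

section \<open>Symmetry of second partial derivatives\<close>

text \<open>The mean value theorem along the direction \<open>a\<close> turns the second difference into an
  increment of \<open>x \<mapsto> f' x a\<close> in the direction \<open>b\<close>.  Since that increment is taken between two points
  near \<open>u\<close>, differentiability of \<open>x \<mapsto> f' x a\<close> at the single point \<open>u\<close> is enough.\<close>

lemma second_difference_estimate:
  fixes f :: "'a::real_normed_vector \<Rightarrow> real"
  assumes "open U" "u \<in> U"
    and df: "\<And>x. x \<in> U \<Longrightarrow> (f has_derivative f' x) (at x)"
    and ddf: "((\<lambda>x. f' x a) has_derivative L) (at u)"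
    and "e > 0"
  shows "\<exists>d>0. \<forall>t. 0 < t \<and> t < d \<longrightarrow>
    \<bar>(f (u + t *\<^sub>R a + t *\<^sub>R b) - f (u + t *\<^sub>R a) - f (u + t *\<^sub>R b) + f u) - t\<^sup>2 * L b\<bar> \<le> e * t\<^sup>2"
proof -
  define M where "M = 2 * (norm a + norm b) + 1"
  have M: "M > 0" unfolding M_def by (simp add: add_nonneg_pos)
  define e' where "e' = e / (2 * M)"
  have e': "e' > 0" using M \<open>e > 0\<close> by (simp add: e'_def)
  obtain r where r: "r > 0" "ball u r \<subseteq> U" using assms(1,2) open_contains_ball by blast
  obtain d0 where d0: "d0 > 0" "\<And>y. norm (y - u) < d0 \<Longrightarrow>
      norm (f' y a - f' u a - L (y - u)) \<le> e' * norm (y - u)"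
    using ddf e' unfolding has_derivative_at_alt by blast
  define d where "d = min r d0 / M"
  have d: "d > 0" using r d0 M by (simp add: d_def)
  interpret L: bounded_linear L using ddf by (rule has_derivative_bounded_linear)
  have "\<bar>(f (u + t *\<^sub>R a + t *\<^sub>R b) - f (u + t *\<^sub>R a) - f (u + t *\<^sub>R b) + f u) - t\<^sup>2 * L b\<bar> \<le> e * t\<^sup>2"
    if t: "0 < t" "t < d" for t
  proof -
    have tM: "t * M < min r d0" using t M by (simp add: d_def pos_less_divide_eq)
    have near: "norm ((u + s *\<^sub>R a + c *\<^sub>R b) - u) \<le> t * M" "norm ((u + s *\<^sub>R a + c *\<^sub>R b) - u) < min r d0"
      if "0 \<le> s" "s \<le> t" "0 \<le> c" "c \<le> t" for s c
    proof -
      have "norm (s *\<^sub>R a + c *\<^sub>R b) \<le> s * norm a + c * norm b"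
        using that by (metis norm_triangle_ineq norm_scaleR abs_of_nonneg)
      also have "\<dots> \<le> t * norm a + t * norm b"
        using that by (intro add_mono mult_right_mono) auto
      also have "\<dots> \<le> t * M"
        using t by (simp add: M_def algebra_simps)
      finally show "norm ((u + s *\<^sub>R a + c *\<^sub>R b) - u) \<le> t * M" by (simp add: algebra_simps)
      then show "norm ((u + s *\<^sub>R a + c *\<^sub>R b) - u) < min r d0" using tM by linarith
    qed
    have inU: "u + s *\<^sub>R a + c *\<^sub>R b \<in> U" if "0 \<le> s" "s \<le> t" "0 \<le> c" "c \<le> t" for s c
      using near(2)[OF that] r(2) by (simp add: subset_iff dist_norm)
        (metis add.assoc add_diff_cancel_left' norm_minus_commute)
    have est: "\<bar>f' (u + s *\<^sub>R a + c *\<^sub>R b) a - f' u a - L (s *\<^sub>R a + c *\<^sub>R b)\<bar> \<le> e' * (t * M)"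
      if "0 \<le> s" "s \<le> t" "0 \<le> c" "c \<le> t" for s c
    proof -
      have "norm (f' (u + s *\<^sub>R a + c *\<^sub>R b) a - f' u a - L ((u + s *\<^sub>R a + c *\<^sub>R b) - u))
          \<le> e' * norm ((u + s *\<^sub>R a + c *\<^sub>R b) - u)"
        by (rule d0(2)) (use near(2)[OF that] in simp)
      also have "\<dots> \<le> e' * (t * M)" by (rule mult_left_mono[OF near(1)[OF that]]) (use e' in simp)
      finally show ?thesis by (simp add: algebra_simps)
    qed
    define g where "g s = f (u + s *\<^sub>R a + t *\<^sub>R b) - f (u + s *\<^sub>R a)" for s
    define g' where "g' s = f' (u + s *\<^sub>R a + t *\<^sub>R b) a - f' (u + s *\<^sub>R a) a" for s
    have curve: "((\<lambda>s. f (u + s *\<^sub>R a + c)) has_real_derivative f' (u + s *\<^sub>R a + c) a) (at s)"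
      if "u + s *\<^sub>R a + c \<in> U" for s c
    proof -
      have "((\<lambda>s. u + s *\<^sub>R a + c) has_derivative (\<lambda>h. h *\<^sub>R a)) (at s)"
        by (auto intro!: derivative_eq_intros)
      from diff_chain_at[OF this df[OF that]]
      have "((\<lambda>s. f (u + s *\<^sub>R a + c)) has_derivative (\<lambda>h. f' (u + s *\<^sub>R a + c) (h *\<^sub>R a))) (at s)"
        by (simp add: o_def)
      then show ?thesis
        using linear_scale[OF has_derivative_linear[OF df[OF that]]]
        by (simp add: has_field_derivative_def mult.commute[of _ "f' _ a"])
    qed
    have "(g has_real_derivative g' s) (at s)" if "0 \<le> s" "s \<le> t" for s
      unfolding g_def[abs_def] g'_def
      using DERIV_diff[OF curve[of s "t *\<^sub>R b"] curve[of s 0]] inU[of s t] inU[of s 0] that t by simp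
    then obtain s where s: "0 < s" "s < t" "g t - g 0 = (t - 0) * g' s"
      using MVT2[of 0 t g g'] t by auto
    have "\<bar>g' s - t * L b\<bar> \<le> e' * (t * M) + e' * (t * M)"
      using est[of s t] est[of s 0] s t unfolding g'_def L.add L.scaleR
      by (simp only: scaleR_zero_left add_0_right real_scaleR_def) linarith
    also have "\<dots> = e * t" using M by (simp add: e'_def field_simps)
    finally have "t * \<bar>g' s - t * L b\<bar> \<le> t * (e * t)" using t by simp
    moreover have "t * \<bar>g' s - t * L b\<bar> = \<bar>t * g' s - t\<^sup>2 * L b\<bar>"
    proof -
      have "t * g' s - t\<^sup>2 * L b = t * (g' s - t * L b)"
        by (simp add: power2_eq_square algebra_simps)
      then show ?thesis using t by (simp add: abs_mult)
    qed
    moreover have "t * g' s = f (u + t *\<^sub>R a + t *\<^sub>R b) - f (u + t *\<^sub>R a) - f (u + t *\<^sub>R b) + f u"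
      using s(3) by (simp add: g_def)
    ultimately show ?thesis by (simp add: power2_eq_square algebra_simps)
  qed
  then show ?thesis using d by blast
qed

text \<open>The second difference is symmetric in \<open>a\<close> and \<open>b\<close>, hence so is its limit after division
  by \<open>t\<^sup>2\<close>.\<close>

lemma second_derivative_symmetric:
  fixes f :: "'a::real_normed_vector \<Rightarrow> real"
  assumes "open U" "u \<in> U"
    and df: "\<And>x. x \<in> U \<Longrightarrow> (f has_derivative f' x) (at x)"
    and La: "((\<lambda>x. f' x a) has_derivative La) (at u)"
    and Lb: "((\<lambda>x. f' x b) has_derivative Lb) (at u)"
  shows "La b = Lb a"
proof (rule ccontr)
  assume ne: "La b \<noteq> Lb a"
  define e where "e = \<bar>La b - Lb a\<bar> / 3"
  have e: "e > 0" using ne by (simp add: e_def)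
  obtain d1 where d1: "d1 > 0" "\<And>t. 0 < t \<Longrightarrow> t < d1 \<Longrightarrow>
      \<bar>(f (u + t *\<^sub>R a + t *\<^sub>R b) - f (u + t *\<^sub>R a) - f (u + t *\<^sub>R b) + f u) - t\<^sup>2 * La b\<bar> \<le> e * t\<^sup>2"
    using second_difference_estimate[OF assms(1-3) La e] by blast
  obtain d2 where d2: "d2 > 0" "\<And>t. 0 < t \<Longrightarrow> t < d2 \<Longrightarrow>
      \<bar>(f (u + t *\<^sub>R b + t *\<^sub>R a) - f (u + t *\<^sub>R b) - f (u + t *\<^sub>R a) + f u) - t\<^sup>2 * Lb a\<bar> \<le> e * t\<^sup>2"
    using second_difference_estimate[OF assms(1-3) Lb e] by blast
  define t where "t = min d1 d2 / 2"
  have t: "0 < t" "t < d1" "t < d2" using d1 d2 by (auto simp: t_def min_def)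
  have "\<bar>t\<^sup>2 * La b - t\<^sup>2 * Lb a\<bar> \<le> 2 * e * t\<^sup>2"
    using d1(2)[OF t(1,2)] d2(2)[OF t(1,3)] by (simp add: algebra_simps)
  moreover have "\<bar>t\<^sup>2 * La b - t\<^sup>2 * Lb a\<bar> = 3 * e * t\<^sup>2"
    using t by (simp add: e_def abs_mult flip: right_diff_distrib)
  ultimately show False using e t by simp
qed

lemma partial_commute:
  fixes f :: "real^'n \<Rightarrow> real"
  assumes "open U" "smooth_on U f" "u \<in> U"
  shows "partial i (partial j f) u = partial j (partial i f) u"
proof -
  have d: "((\<lambda>x. frechet_derivative f (at x) (axis k 1)) has_derivative
      frechet_derivative (partial k f) (at u)) (at u)" for k
    using smooth_on_has_derivative[OF assms(1) smooth_on_partial[OF assms(2)] assms(3), of k]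
    by (simp add: partial_def[abs_def])
  show ?thesis
    using second_derivative_symmetric[OF assms(1,3) smooth_on_has_derivative[OF assms(1,2)] d[of j] d[of i]]
    by (simp add: partial_def)
qed

section \<open>Flat metrics from closed frames\<close>

lemma partial_vec_nth:
  assumes "open U" "smooth_on U f" "u \<in> U"
  shows "partial i (\<lambda>x. f x $ m) u = partial i f u $ m"
  using partial_eqI[OF bounded_linear.has_derivative[OF bounded_linear_vec_nth
        smooth_on_has_derivative[OF assms]]]
  by (simp add: partial_def)

lemma partial_commute_vec:
  fixes f :: "real^'n \<Rightarrow> real^'m"
  assumes "open U" "smooth_on U f" "u \<in> U"
  shows "partial i (partial j f) u = partial j (partial i f) u"
proof -
  have "partial i (partial j f) u $ m = partial i (partial j (\<lambda>x. f x $ m)) u" for i j m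
  proof -
    have "partial i (\<lambda>x. partial j f x $ m) u = partial i (partial j (\<lambda>x. f x $ m)) u"
      by (rule partial_cong_open[OF assms(1,3)]) (simp add: partial_vec_nth[OF assms(1,2)])
    then show ?thesis
      by (simp add: partial_vec_nth[OF assms(1) smooth_on_partial[OF assms(2)] assms(3)])
  qed
  then show ?thesis
    using partial_commute[OF assms(1) smooth_on_bounded_linear[OF bounded_linear_vec_nth assms(1,2)] assms(3)]
    by (simp add: vec_eq_iff)
qed

lemma partial_inner:
  fixes f g :: "real^'n \<Rightarrow> 'b::real_inner"
  assumes "open U" "smooth_on U f" "smooth_on U g" "u \<in> U"
  shows "partial i (\<lambda>x. f x \<bullet> g x) u = f u \<bullet> partial i g u + partial i f u \<bullet> g u"
  using partial_eqI[OF has_derivative_inner[OF smooth_on_has_derivative[OF assms(1,2,4)]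
        smooth_on_has_derivative[OF assms(1,3,4)]], of i]
  by (simp add: partial_def)

text \<open>A one-sided inverse of a square matrix is two-sided: \<open>T i \<bullet> S j = \<delta>\<^sub>i\<^sub>j\<close> gives
  \<open>\<Sum>\<^sub>l T l (S l)\<^sup>t = I\<close>.\<close>

lemma dual_frame_expansion:
  fixes T S :: "'n \<Rightarrow> real^'n"
  assumes "\<And>i j. T i \<bullet> S j = (if i = j then 1 else 0)"
  shows "(\<Sum>l\<in>UNIV. (v \<bullet> T l) * (S l \<bullet> w)) = v \<bullet> w"
proof -
  define A where "A = (\<chi> i. T i)"
  define B where "B = (\<chi> i. S i)"
  have "A ** transpose B = mat 1"
    using assms by (simp add: A_def B_def vec_eq_iff matrix_matrix_mult_def transpose_def mat_def inner_vec_def)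
  then have "transpose B ** A = mat 1"
    by (simp add: matrix_left_right_inverse)
  then have "w = transpose A *v (B *v w)"
    by (metis matrix_transpose_mul matrix_vector_mul_assoc matrix_vector_mul_lid transpose_mat transpose_transpose)
  then have "v \<bullet> w = v \<bullet> (transpose A *v (B *v w))" by simp
  also have "\<dots> = (A *v v) \<bullet> (B *v w)"
    by (metis dot_lmul_matrix vector_transpose_matrix transpose_transpose)
  also have "\<dots> = (\<Sum>l\<in>UNIV. (v \<bullet> T l) * (S l \<bullet> w))"
    by (simp add: A_def B_def inner_vec_def matrix_vector_mult_def mult.commute)
  finally show ?thesis by simp
qed

lemma matrix_inv_eqI:
  fixes A B :: "real^'n^'n"
  assumes "A ** B = mat 1"
  shows "matrix_inv A = B"
proof -
  have "B ** A = mat 1" using assms matrix_left_right_inverse by blast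
  then have "invertible A" using assms unfolding invertible_def by blast
  then have "matrix_inv A ** A = mat 1"
    unfolding invertible_def matrix_inv_def by (rule someI2_ex) simp
  then show ?thesis
    by (metis assms matrix_mul_assoc matrix_mul_lid matrix_mul_rid)
qed

text \<open>A frame with \<open>\<partial>\<^sub>i T\<^sub>j = \<partial>\<^sub>j T\<^sub>i\<close> consists locally of the coordinate vector fields of a map
  into Euclidean space, and \<open>g\<close> is the pulled back metric.  Expanding in \<open>T\<close> gives \<open>\<Gamma>\<^sup>k\<^sub>i\<^sub>j = S\<^sub>k \<bullet> \<partial>\<^sub>i T\<^sub>j\<close>, and then the curvature component is the
  inner product of \<open>S\<^sub>l\<close> with \<open>\<partial>\<^sub>i \<partial>\<^sub>j T\<^sub>k - \<partial>\<^sub>j \<partial>\<^sub>i T\<^sub>k = 0\<close>.\<close>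

lemma riemann_eq_0_of_closed_frame:
  fixes T S :: "'n \<Rightarrow> real^'n \<Rightarrow> real^'n"
  assumes V: "open V"
    and T: "\<And>j. smooth_on V (T j)" and S: "\<And>j. smooth_on V (S j)"
    and dual: "\<And>u i j. u \<in> V \<Longrightarrow> T i u \<bullet> S j u = (if i = j then 1 else 0)"
    and closed: "\<And>u i j. u \<in> V \<Longrightarrow> partial i (T j) u = partial j (T i) u"
    and g: "\<And>u. u \<in> V \<Longrightarrow> g u = (\<chi> i j. T i u \<bullet> T j u)"
    and "u \<in> V"
  shows "riemann g l k i j u = 0"
proof -
  have expand: "(\<Sum>l\<in>UNIV. (v \<bullet> T l x) * (S l x \<bullet> w)) = v \<bullet> w" if "x \<in> V" for x v w
    by (rule dual_frame_expansion) (rule dual[OF that])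
  have inv: "matrix_inv (g x) = (\<chi> k l. S k x \<bullet> S l x)" if x: "x \<in> V" for x
  proof (rule matrix_inv_eqI)
    have "(\<Sum>m\<in>UNIV. (T i x \<bullet> T m x) * (S m x \<bullet> S j x)) = (if i = j then 1 else 0)" for i j
      using expand[OF x] dual[OF x] by simp
    then show "g x ** (\<chi> k l. S k x \<bullet> S l x) = mat 1"
      by (simp add: g[OF x] vec_eq_iff matrix_matrix_mult_def mat_def)
  qed
  have dg: "partial i (\<lambda>y. g y $ j $ l) x = T j x \<bullet> partial i (T l) x + partial i (T j) x \<bullet> T l x"
    if x: "x \<in> V" for x i j l
  proof -
    have "partial i (\<lambda>y. g y $ j $ l) x = partial i (\<lambda>y. T j y \<bullet> T l y) x"
      by (rule partial_cong_open[OF V x]) (simp add: g)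
    then show ?thesis by (simp add: partial_inner[OF V T T x])
  qed
  have chr: "christoffel g k i j x = S k x \<bullet> partial i (T j) x" if x: "x \<in> V" for x k i j
  proof -
    have "partial i (\<lambda>y. g y $ j $ l) x + partial j (\<lambda>y. g y $ i $ l) x - partial l (\<lambda>y. g y $ i $ j) x
        = 2 * (partial i (T j) x \<bullet> T l x)" for l
      using closed[OF x] by (simp add: dg[OF x] inner_commute)
    then have chr_sum: "christoffel g k i j x
        = (\<Sum>l\<in>UNIV. (partial i (T j) x \<bullet> T l x) * (S l x \<bullet> S k x))"
      by (simp add: christoffel_def inv[OF x] sum_distrib_left inner_commute mult_ac)
    have "christoffel g k i j x = partial i (T j) x \<bullet> S k x" unfolding chr_sum by (rule expand[OF x])
    then show ?thesis by (simp add: inner_commute)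
  qed
  have dS: "partial i (S l) u \<bullet> T m u = - (S l u \<bullet> partial i (T m) u)" for i l m
  proof -
    have "partial i (\<lambda>y. S l y \<bullet> T m y) u = partial i (\<lambda>y. if m = l then 1 else 0 :: real) u"
      by (rule partial_cong_open[OF V \<open>u \<in> V\<close>]) (use dual[of _ m l] in \<open>simp add: inner_commute\<close>)
    also have "\<dots> = 0" by (simp add: partial_def)
    finally show ?thesis by (simp add: partial_inner[OF V S T \<open>u \<in> V\<close>])
  qed
  \<comment> \<open>The product term is \<open>- \<partial>\<^sub>i S\<^sub>l \<bullet> \<partial>\<^sub>j T\<^sub>k\<close>, expanded with the help of \<open>dS\<close>.\<close>
  have half: "partial i (christoffel g l j k) u
      + (\<Sum>m\<in>UNIV. christoffel g l i m u * christoffel g m j k u)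
      = S l u \<bullet> partial i (partial j (T k)) u" for i j l k
  proof -
    have "partial i (christoffel g l j k) u = partial i (\<lambda>y. S l y \<bullet> partial j (T k) y) u"
      by (rule partial_cong_open[OF V \<open>u \<in> V\<close>]) (simp add: chr)
    also have "\<dots> = S l u \<bullet> partial i (partial j (T k)) u + partial i (S l) u \<bullet> partial j (T k) u"
      by (rule partial_inner[OF V S smooth_on_partial[OF T] \<open>u \<in> V\<close>])
    also have "partial i (S l) u \<bullet> partial j (T k) u
        = (\<Sum>m\<in>UNIV. (partial i (S l) u \<bullet> T m u) * (S m u \<bullet> partial j (T k) u))"
      by (simp add: expand[OF \<open>u \<in> V\<close>])
    also have "\<dots> = - (\<Sum>m\<in>UNIV. christoffel g l i m u * christoffel g m j k u)"
      by (simp add: dS chr[OF \<open>u \<in> V\<close>] sum_negf)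
    finally show ?thesis by simp
  qed
  have "riemann g l k i j u = S l u \<bullet> partial i (partial j (T k)) u - S l u \<bullet> partial j (partial i (T k)) u"
    unfolding riemann_def half[symmetric] sum_subtractf by simp
  then show ?thesis
    using partial_commute_vec[OF V T \<open>u \<in> V\<close>, of i j k] by simp
qed

section \<open>Differentiating with respect to a parameter\<close>

text \<open>Here \<open>H k\<close> solves a linear equation with a small coefficient
  \<open>m k\<close>, and the limit \<open>K\<close> of \<open>(H k - e) / m k\<close> is its first order term in the parameter.  Around
  each point there is a ball on which convergence at one point \<open>q\<close> forces convergence everywhere:
  the mean value inequality bounds \<open>H k\<close> by a multiple of its value at \<open>q\<close>, hence \<open>H k \<rightarrow> e\<close> uniformly,
  and therefore the derivatives \<open>A u v (H k u)\<close> of the quotients converge uniformly.  The set of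
  points of convergence is thus open and closed in \<open>U\<close>, and it contains \<open>p\<close>, where all
  quotients vanish.\<close>

lemma difference_quotient_limit:
  fixes H :: "nat \<Rightarrow> 'a::euclidean_space \<Rightarrow> 'b::banach"
    and A :: "'a \<Rightarrow> 'a \<Rightarrow> 'b \<Rightarrow> 'b"
  assumes U: "open U" "connected U" "p \<in> U"
    and dH: "\<And>k u. u \<in> U \<Longrightarrow> (H k has_derivative (\<lambda>v. m k *\<^sub>R A u v (H k u))) (at u)"
    and Hp: "\<And>k. H k p = e"
    and m: "m \<longlonglongrightarrow> 0" "\<And>k. m k \<noteq> 0"
    and lin: "\<And>u v. linear (A u v)"
    and bnd: "\<And>u v w. u \<in> U \<Longrightarrow> norm (A u v w) \<le> c u * norm v * norm w"
    and c: "continuous_on U c"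
  shows "\<exists>K. K p = 0 \<and> (\<forall>u\<in>U. (K has_derivative (\<lambda>v. A u v e)) (at u))"
proof -
  define D where "D k u = (H k u - e) /\<^sub>R m k" for k u
  have dD: "(D k has_derivative (\<lambda>v. A u v (H k u))) (at u)" if "u \<in> U" for k u
    unfolding D_def[abs_def] using m(2)[of k]
    by (auto intro!: derivative_eq_intros dH[OF that])
  have HD: "H k u = e + m k *\<^sub>R D k u" for k u
    using m(2)[of k] by (simp add: D_def)
  have local: "\<exists>r>0. cball a r \<subseteq> U \<and> (\<forall>p\<in>cball a r. convergent (\<lambda>k. D k p) \<longrightarrow>
      (\<exists>g. \<forall>x\<in>cball a r. (\<lambda>k. D k x) \<longlonglongrightarrow> g x \<and>
        (g has_derivative (\<lambda>v. A x v e)) (at x within cball a r)))" if a: "a \<in> U" for a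
  proof -
    obtain r where r: "r > 0" "cball a r \<subseteq> U" using U(1) a open_contains_cball by blast
    have "compact (c ` cball a r)"
      by (intro compact_continuous_image continuous_on_subset[OF c r(2)]) auto
    then obtain C where C: "C > 0" "\<And>x. x \<in> cball a r \<Longrightarrow> norm (c x) \<le> C"
      using bounded_pos compact_imp_bounded by (metis imageI)
    have bndC: "norm (A x v w) \<le> C * norm v * norm w" if "x \<in> cball a r" for x v w
    proof -
      have "norm (A x v w) \<le> c x * norm v * norm w" using bnd that r(2) by blast
      also have "\<dots> \<le> C * norm v * norm w"
        using C(2)[OF that] by (intro mult_right_mono) auto
      finally show ?thesis .
    qed
    have "\<exists>g. \<forall>x\<in>cball a r. (\<lambda>k. D k x) \<longlonglongrightarrow> g x \<and>
        (g has_derivative (\<lambda>v. A x v e)) (at x within cball a r)"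
      if q: "q \<in> cball a r" and conv: "convergent (\<lambda>k. D k q)" for q
    proof -
      obtain l where l: "(\<lambda>k. D k q) \<longlonglongrightarrow> l" using conv by (auto simp: convergent_def)
      have Hq: "(\<lambda>k. H k q) \<longlonglongrightarrow> e"
        using tendsto_add[OF tendsto_const tendsto_scaleR[OF m(1) l], of e] by (simp add: HD)
      have diff: "norm (H k x - H k q) \<le> \<bar>m k\<bar> * (C * M * (2 * r))"
        if M: "\<And>z. z \<in> cball a r \<Longrightarrow> norm (H k z) \<le> M" and x: "x \<in> cball a r" for k M x
      proof -
        have M0: "M \<ge> 0" using M[OF x] norm_ge_zero order_trans by blast
        have "norm (H k x - H k q) \<le> (\<bar>m k\<bar> * (C * M)) * norm (x - q)"
        proof (rule differentiable_bound[OF convex_cball _ _ x q])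
          fix z assume z: "z \<in> cball a r"
          show "(H k has_derivative (\<lambda>v. m k *\<^sub>R A z v (H k z))) (at z within cball a r)"
            using dH r(2) z by (blast intro: has_derivative_at_withinI)
          show "onorm (\<lambda>v. m k *\<^sub>R A z v (H k z)) \<le> \<bar>m k\<bar> * (C * M)"
          proof (rule onorm_le)
            fix v
            have "norm (A z v (H k z)) \<le> C * norm v * norm (H k z)" by (rule bndC[OF z])
            also have "\<dots> \<le> C * norm v * M" by (intro mult_left_mono M z) (use C in simp)
            finally have "\<bar>m k\<bar> * norm (A z v (H k z)) \<le> \<bar>m k\<bar> * (C * norm v * M)"
              by (rule mult_left_mono) simp
            then show "norm (m k *\<^sub>R A z v (H k z)) \<le> \<bar>m k\<bar> * (C * M) * norm v"
              by (simp add: mult_ac)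
          qed
        qed
        also have "\<dots> \<le> (\<bar>m k\<bar> * (C * M)) * (2 * r)"
        proof (rule mult_left_mono)
          show "norm (x - q) \<le> 2 * r"
            using x q dist_triangle3[of x q a] by (simp add: dist_norm)
        qed (use C M0 in simp)
        finally show ?thesis by (simp add: mult_ac)
      qed
      define M where "M = 2 * (norm e + 1)"
      have "eventually (\<lambda>k. norm (H k q) < norm e + 1) sequentially"
        using order_tendstoD(2)[OF tendsto_norm[OF Hq], of "norm e + 1"] by simp
      moreover have "eventually (\<lambda>k. \<bar>m k\<bar> * (C * (2 * r)) < 1 / 2) sequentially"
        using order_tendstoD(2)[OF tendsto_mult_left_zero[OF tendsto_rabs_zero[OF m(1)], of "C * (2 * r)"], of "1 / 2"]
        by simp
      ultimately have Mev: "eventually (\<lambda>k. \<forall>z\<in>cball a r. norm (H k z) \<le> M) sequentially"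
      proof eventually_elim
        case (elim k)
        have "continuous_on (cball a r) (\<lambda>z. norm (H k z))"
          using dH r(2) by (intro continuous_on_norm has_derivative_continuous_on)
            (blast intro: has_derivative_at_withinI)
        then obtain w where w: "w \<in> cball a r" "\<And>z. z \<in> cball a r \<Longrightarrow> norm (H k z) \<le> norm (H k w)"
          using continuous_attains_sup[of "cball a r" "\<lambda>z. norm (H k z)"] q
          by (metis compact_cball empty_iff)
        \<comment> \<open>At the point \<open>w\<close> where the norm is maximal the increment is at most half of the maximum,
          so the maximum can be absorbed into the left hand side.\<close>
        have "norm (H k w) \<le> norm (H k q) + norm (H k w - H k q)"
          by (metis add.commute diff_add_cancel norm_triangle_ineq)
        also have "\<dots> \<le> (norm e + 1) + \<bar>m k\<bar> * (C * norm (H k w) * (2 * r))"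
          using elim(1) diff[OF w(2) w(1)] by linarith
        also have "\<dots> = (norm e + 1) + (\<bar>m k\<bar> * (C * (2 * r))) * norm (H k w)" by simp
        also have "\<dots> \<le> (norm e + 1) + 1 / 2 * norm (H k w)"
          using elim(2) by (intro add_left_mono mult_right_mono) auto
        finally have "norm (H k w) \<le> M" by (simp add: M_def)
        then show ?case using w(2) order_trans by blast
      qed
      have unif: "eventually (\<lambda>k. \<forall>x\<in>cball a r. norm (H k x - e) \<le> s) sequentially" if "s > 0" for s
      proof -
        have "eventually (\<lambda>k. norm (H k q - e) < s / 2) sequentially"
          using tendstoD[OF Hq, of "s / 2"] \<open>s > 0\<close> by (simp add: dist_norm)
        moreover have "eventually (\<lambda>k. \<bar>m k\<bar> * (C * M * (2 * r)) < s / 2) sequentially"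
          using order_tendstoD(2)[OF tendsto_mult_left_zero[OF tendsto_rabs_zero[OF m(1)], of "C * M * (2 * r)"], of "s / 2"]
            \<open>s > 0\<close> by simp
        ultimately show ?thesis using Mev
        proof eventually_elim
          case (elim k)
          show ?case
          proof
            fix x assume x: "x \<in> cball a r"
            have "norm (H k x - e) \<le> norm (H k x - H k q) + norm (H k q - e)"
              by (metis diff_add_cancel add_diff_eq norm_triangle_ineq)
            then show "norm (H k x - e) \<le> s"
              using diff[of k M x] elim x by fastforce
          qed
        qed
      qed
      show ?thesis
      proof (rule has_derivative_sequence[where ?x0.0 = q and l = l and f' = "\<lambda>k x v. A x v (H k x)"])
        show "convex (cball a r)" "q \<in> cball a r" "(\<lambda>k. D k q) \<longlonglongrightarrow> l"
          using q l by simp_all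
        show "(D k has_derivative (\<lambda>v. A x v (H k x))) (at x within cball a r)"
          if "x \<in> cball a r" for k x
          using dD that r(2) by (blast intro: has_derivative_at_withinI)
        fix s :: real assume s: "s > 0"
        have "eventually (\<lambda>k. \<forall>x\<in>cball a r. norm (H k x - e) \<le> s / C) sequentially"
          using unif s C by simp
        then show "eventually (\<lambda>k. \<forall>x\<in>cball a r. \<forall>v. norm (A x v (H k x) - A x v e) \<le> s * norm v) sequentially"
        proof eventually_elim
          case (elim k)
          show ?case
          proof (intro ballI allI)
            fix x v assume x: "x \<in> cball a r"
            have "norm (A x v (H k x) - A x v e) = norm (A x v (H k x - e))"
              by (simp add: linear_diff[OF lin])
            also have "\<dots> \<le> C * norm v * norm (H k x - e)" by (rule bndC[OF x])
            also have "\<dots> \<le> C * norm v * (s / C)"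
              using elim x C by (intro mult_left_mono) auto
            finally show "norm (A x v (H k x) - A x v e) \<le> s * norm v" using C(1) by (simp add: mult.commute)
          qed
        qed
      qed
    qed
    then show ?thesis using r by blast
  qed
  have conv: "convergent (\<lambda>k. D k x)" if "x \<in> U" for x
  proof (rule connected_induction_simple[OF U(2) U(3) that, where P = "\<lambda>x. convergent (\<lambda>k. D k x)"])
    show "convergent (\<lambda>k. D k p)" by (simp add: D_def Hp convergent_const)
    fix a assume "a \<in> U"
    then obtain r where r: "r > 0" "cball a r \<subseteq> U"
      "\<And>q. q \<in> cball a r \<Longrightarrow> convergent (\<lambda>k. D k q) \<Longrightarrow>
        \<exists>g. \<forall>x\<in>cball a r. (\<lambda>k. D k x) \<longlonglongrightarrow> g x \<and> (g has_derivative (\<lambda>v. A x v e)) (at x within cball a r)"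
      using local[OF \<open>a \<in> U\<close>] by metis
    have "\<forall>x\<in>ball a r. \<forall>y\<in>ball a r. convergent (\<lambda>k. D k x) \<longrightarrow> convergent (\<lambda>k. D k y)"
      using r(3) ball_subset_cball unfolding convergent_def by (meson subsetD)
    moreover have "openin (top_of_set U) (ball a r)"
      using r(2) ball_subset_cball[of a r] by (intro open_subset) auto
    ultimately show "\<exists>T. openin (top_of_set U) T \<and> a \<in> T \<and>
        (\<forall>x\<in>T. \<forall>y\<in>T. convergent (\<lambda>k. D k x) \<longrightarrow> convergent (\<lambda>k. D k y))"
      using r(1) by (intro exI[of _ "ball a r"]) simp
  qed
  define K where "K u = lim (\<lambda>k. D k u)" for u
  have "(K has_derivative (\<lambda>v. A u v e)) (at u)" if u: "u \<in> U" for u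
  proof -
    obtain r g where r: "r > 0" "cball u r \<subseteq> U"
      and g: "\<And>x. x \<in> cball u r \<Longrightarrow> (\<lambda>k. D k x) \<longlonglongrightarrow> g x"
        "\<And>x. x \<in> cball u r \<Longrightarrow> (g has_derivative (\<lambda>v. A x v e)) (at x within cball u r)"
      using local[OF u] conv[OF u] by (metis centre_in_cball less_imp_le)
    have "(g has_derivative (\<lambda>v. A u v e)) (at u)"
      using at_within_open[of u "ball u r"] has_derivative_subset[OF g(2) ball_subset_cball, of u] r(1)
      by simp
    then show ?thesis
      by (rule has_derivative_transform_within_open[of _ _ _ _ "ball u r"])
        (use r(1) limI[OF g(1)] in \<open>auto simp: K_def\<close>)
  qed
  moreover have "K p = 0" by (simp add: K_def D_def Hp)
  ultimately show ?thesis by blast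
qed

section \<open>Matrix calculus\<close>

lemma bounded_bilinear_matrix_mult:
  "bounded_bilinear ((**) :: real^'k^'m \<Rightarrow> real^'n^'k \<Rightarrow> real^'n^'m)"
  unfolding bilinear_conv_bounded_bilinear[symmetric] bilinear_def
  by (auto intro!: linearI
      simp: vec_eq_iff matrix_matrix_mult_def algebra_simps sum.distrib sum_distrib_left)

lemma bounded_bilinear_matrix_vector_mult:
  "bounded_bilinear ((*v) :: real^'n^'m \<Rightarrow> real^'n \<Rightarrow> real^'m)"
  unfolding bilinear_conv_bounded_bilinear[symmetric] bilinear_def
  by (auto intro!: linearI
      simp: vec_eq_iff matrix_vector_mult_def algebra_simps sum.distrib sum_distrib_left)

lemma bounded_linear_transpose: "bounded_linear (transpose :: real^'n^'m \<Rightarrow> real^'m^'n)"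
  unfolding linear_conv_bounded_linear[symmetric]
  by (auto intro!: linearI simp: vec_eq_iff transpose_def)

lemma bounded_linear_diag_mat: "bounded_linear (diag_mat :: real^'n \<Rightarrow> real^'n^'n)"
  unfolding linear_conv_bounded_linear[symmetric]
  by (auto intro!: linearI simp: vec_eq_iff diag_mat_def)

lemmas matrix_mult_linear_simps =
  bounded_bilinear.add_left[OF bounded_bilinear_matrix_mult]
  bounded_bilinear.add_right[OF bounded_bilinear_matrix_mult]
  bounded_bilinear.diff_left[OF bounded_bilinear_matrix_mult]
  bounded_bilinear.diff_right[OF bounded_bilinear_matrix_mult]
  bounded_bilinear.minus_left[OF bounded_bilinear_matrix_mult]
  bounded_bilinear.minus_right[OF bounded_bilinear_matrix_mult]
  bounded_bilinear.scaleR_left[OF bounded_bilinear_matrix_mult]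
  bounded_bilinear.scaleR_right[OF bounded_bilinear_matrix_mult]
  bounded_bilinear.zero_left[OF bounded_bilinear_matrix_mult]
  bounded_bilinear.zero_right[OF bounded_bilinear_matrix_mult]

lemmas matrix_vector_linear_simps =
  bounded_bilinear.add_left[OF bounded_bilinear_matrix_vector_mult]
  bounded_bilinear.add_right[OF bounded_bilinear_matrix_vector_mult]
  bounded_bilinear.diff_left[OF bounded_bilinear_matrix_vector_mult]
  bounded_bilinear.diff_right[OF bounded_bilinear_matrix_vector_mult]
  bounded_bilinear.minus_left[OF bounded_bilinear_matrix_vector_mult]
  bounded_bilinear.minus_right[OF bounded_bilinear_matrix_vector_mult]
  bounded_bilinear.scaleR_left[OF bounded_bilinear_matrix_vector_mult]
  bounded_bilinear.scaleR_right[OF bounded_bilinear_matrix_vector_mult]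
  bounded_bilinear.zero_left[OF bounded_bilinear_matrix_vector_mult]
  bounded_bilinear.zero_right[OF bounded_bilinear_matrix_vector_mult]

lemmas transpose_linear_simps =
  linear_add[OF bounded_linear.linear[OF bounded_linear_transpose]]
  linear_diff[OF bounded_linear.linear[OF bounded_linear_transpose]]
  linear_neg[OF bounded_linear.linear[OF bounded_linear_transpose]]
  linear_scale[OF bounded_linear.linear[OF bounded_linear_transpose]]

lemmas matrix_ring_simps =
  matrix_mult_linear_simps matrix_mul_assoc[symmetric] matrix_mul_lid matrix_mul_rid

lemmas matrix_vector_simps =
  matrix_ring_simps matrix_vector_linear_simps matrix_vector_mul_assoc[symmetric]

lemmas matrix_mult_has_derivative = bounded_bilinear.FDERIV[OF bounded_bilinear_matrix_mult]
lemmas matrix_vector_has_derivative = bounded_bilinear.FDERIV[OF bounded_bilinear_matrix_vector_mult]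

text \<open>The default rule turns \<open>transpose A *v x\<close> into \<open>x v* A\<close>, for which the bilinearity and
  associativity rules above have no counterpart.\<close>

declare transpose_matrix_vector [simp del]

lemma inner_transpose_matrix: "(transpose A *v x) \<bullet> y = x \<bullet> (A *v (y :: real^'n))"
  by (metis dot_lmul_matrix transpose_matrix_vector)

lemma transpose_diag_mat: "transpose (diag_mat v) = diag_mat v"
  by (auto simp: vec_eq_iff transpose_def diag_mat_def)

lemma det_differentiable:
  fixes M :: "'a::real_normed_vector \<Rightarrow> real^'n^'n"
  assumes "\<And>i j. (\<lambda>x. M x $ i $ j) differentiable (at u)"
  shows "(\<lambda>x. det (M x)) differentiable (at u)"
proof -
  have "(\<lambda>x. \<Prod>i\<in>I. M x $ i $ p i) differentiable (at u)" for p and I :: "'n set"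
    by (induction I rule: infinite_finite_induct) (auto intro: differentiable_mult assms)
  then show ?thesis
    unfolding det_def by (intro differentiable_sum differentiable_mult differentiable_const) auto
qed

lemma matrix_inv_cancel:
  fixes M :: "real^'n^'n"
  assumes "invertible M"
  shows "M ** matrix_inv M = mat 1" "matrix_inv M ** M = mat 1"
  using assms matrix_inv_eqI unfolding invertible_def by metis+

text \<open>Cramer's rule, from which differentiability of the inverse follows entry by entry.\<close>

lemma matrix_inv_entry:
  fixes M :: "real^'n^'n"
  assumes "invertible M"
  shows "matrix_inv M $ k $ j
    = det (\<chi> i l. if l = k then axis j 1 $ i else M $ i $ l) / det M"
proof -
  have "M *v (matrix_inv M *v axis j 1) = axis j 1"
    by (simp add: matrix_vector_mul_assoc matrix_inv_cancel[OF assms])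
  then have "matrix_inv M *v axis j 1 = (\<chi> k. det (\<chi> i l. if l = k then axis j 1 $ i else M $ i $ l) / det M)"
    using cramer[of M] assms by (simp add: invertible_det_nz)
  moreover have "(matrix_inv M *v axis j 1) $ k = matrix_inv M $ k $ j"
    by (simp add: matrix_vector_mult_basis column_def)
  ultimately show ?thesis by simp
qed

lemma matrix_entry_differentiable:
  fixes M :: "'a::real_normed_vector \<Rightarrow> real^'n^'m"
  assumes "M differentiable (at u)"
  shows "(\<lambda>x. M x $ i $ j) differentiable (at u)"
  using assms bounded_linear.has_derivative[OF bounded_linear_compose[OF bounded_linear_vec_nth bounded_linear_vec_nth]]
  unfolding differentiable_def by blast

lemma differentiable_transform_open:
  assumes "f differentiable (at u)" "open U" "u \<in> U" "\<And>x. x \<in> U \<Longrightarrow> f x = g x"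
  shows "g differentiable (at u)"
  using assms has_derivative_transform_within_open unfolding differentiable_def by blast

lemma matrix_inv_differentiable:
  fixes M :: "'a::real_normed_vector \<Rightarrow> real^'n^'n"
  assumes "M differentiable (at u)" "open U" "u \<in> U" "\<And>x. x \<in> U \<Longrightarrow> invertible (M x)"
  shows "(\<lambda>x. matrix_inv (M x)) differentiable (at u)"
proof -
  note entry = matrix_entry_differentiable[OF assms(1)]
  have "(\<lambda>x. det (\<chi> i l. if l = k then axis j 1 $ i else M x $ i $ l) / det (M x)) differentiable (at u)"
    for k j
  proof (rule differentiable_divide)
    show "(\<lambda>x. det (\<chi> i l. if l = k then axis j 1 $ i else M x $ i $ l)) differentiable (at u)"
    proof (rule det_differentiable)
      show "(\<lambda>x. (\<chi> i l. if l = k then axis j 1 $ i else M x $ i $ l) $ i $ l) differentiable (at u)" for i l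
        by (cases "l = k") (simp_all add: entry)
    qed
    show "(\<lambda>x. det (M x)) differentiable (at u)"
      by (rule det_differentiable) (rule entry)
    show "det (M u) \<noteq> 0" using assms(3,4) by (simp add: invertible_det_nz)
  qed
  note quot = this
  have "(\<lambda>x. matrix_inv (M x) $ k $ j) differentiable (at u)" for k j
    by (rule differentiable_transform_open[OF quot[of k j] assms(2,3)])
      (simp only: matrix_inv_entry[OF assms(4)])
  then obtain f' where f': "\<And>k j. ((\<lambda>x. matrix_inv (M x) $ k $ j) has_derivative f' k j) (at u)"
    unfolding differentiable_def by metis
  have "((\<lambda>x. matrix_inv (M x)) has_derivative (\<lambda>v. \<chi> k j. f' k j v)) (at u)"
    by (intro has_derivative_vec) (simp add: f')
  then show ?thesis unfolding differentiable_def by blast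
qed

section \<open>Real frames of the associated family\<close>

definition mcomm :: "real^'n^'n \<Rightarrow> real^'n^'n \<Rightarrow> real^'n^'n" where
  "mcomm A B = A ** B - B ** A"

lemma transpose_mcomm:
  assumes "transpose B = B"
  shows "transpose (mcomm (diag_mat v) B) = - mcomm (diag_mat v) B"
  by (simp add: mcomm_def transpose_linear_simps matrix_transpose_mul transpose_diag_mat assms)

text \<open>For \<open>\<lambda> = - \<i> s\<close> with real \<open>s\<close> the connection form \<open>\<i> \<lambda> \<delta> + [\<delta>, \<beta>]\<close> of the associated family is the
  real form \<open>s \<delta> + [\<delta>, \<beta>]\<close>.  The locale collects the real frames \<open>G s\<close> and the vectors \<open>x s\<close> that
  arise for these values of the spectral parameter.\<close>

locale lax_frames =
  fixes U :: "(real^'n) set"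
    and h :: "real^'n \<Rightarrow> real^'n"
    and \<beta> :: "real^'n \<Rightarrow> real^'n^'n"
    and G :: "real \<Rightarrow> real^'n \<Rightarrow> real^'n^'n"
    and x :: "real \<Rightarrow> real^'n \<Rightarrow> real^'n"
  assumes open_U: "open U" and connected_U: "connected U" and zero_in_U: "0 \<in> U"
    and \<beta>_sym: "u \<in> U \<Longrightarrow> transpose (\<beta> u) = \<beta> u"
    and frame_has_derivative: "u \<in> U \<Longrightarrow>
      (G s has_derivative (\<lambda>v. G s u ** (s *\<^sub>R diag_mat v + mcomm (diag_mat v) (\<beta> u)))) (at u)"
    and frame_0: "G s 0 = mat 1"
    and position_has_derivative: "u \<in> U \<Longrightarrow>
      (x s has_derivative (\<lambda>v. G s u *v (diag_mat v *v h u))) (at u)"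
    and position_0: "x s 0 = 0"
begin

lemma constant_of_zero_derivative:
  fixes f :: "real^'n \<Rightarrow> 'b::real_normed_vector"
  assumes "\<And>u. u \<in> U \<Longrightarrow> (f has_derivative (\<lambda>v. 0)) (at u)" "u \<in> U"
  shows "f u = f 0"
  using has_derivative_zero_unique_connected[OF open_U connected_U assms(1) assms(2) zero_in_U] .

lemma frame_transpose_has_derivative:
  assumes "u \<in> U"
  shows "((\<lambda>u. transpose (G s u)) has_derivative
    (\<lambda>v. (s *\<^sub>R diag_mat v - mcomm (diag_mat v) (\<beta> u)) ** transpose (G s u))) (at u)"
  using bounded_linear.has_derivative[OF bounded_linear_transpose frame_has_derivative[OF assms]]
  by (simp add: matrix_transpose_mul transpose_linear_simps transpose_diag_mat
      transpose_mcomm[OF \<beta>_sym[OF assms]])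

text \<open>The reality condition of the family: \<open>G s\<close> and the transpose of \<open>G (- s)\<close> satisfy adjoint
  equations because \<open>[\<delta>, \<beta>]\<close> is skew-symmetric, so their product is constant.  In particular
  every \<open>G s\<close> is invertible, and \<open>G 0\<close> is orthogonal.\<close>

lemma frame_inverse:
  assumes "u \<in> U"
  shows "G s u ** transpose (G (- s) u) = mat 1" "transpose (G (- s) u) ** G s u = mat 1"
proof -
  have "((\<lambda>u. G s u ** transpose (G (- s) u)) has_derivative (\<lambda>v. 0)) (at u)" if "u \<in> U" for u
    using matrix_mult_has_derivative[OF frame_has_derivative[OF that] frame_transpose_has_derivative[OF that], of s "-s"]
    by (simp add: matrix_ring_simps)
  from constant_of_zero_derivative[OF this assms]
  show "G s u ** transpose (G (- s) u) = mat 1"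
    by (simp add: frame_0)
  then show "transpose (G (- s) u) ** G s u = mat 1"
    by (simp add: matrix_left_right_inverse)
qed

text \<open>The solution \<open>K\<close> is the logarithmic derivative of \<open>G\<close> with respect to the spectral
  parameter, \<open>K = (\<partial>G / \<partial>s) G\<^sup>-\<^sup>1\<close> at \<open>s = a\<close>: the matrices \<open>H = G (a + m) G (a)\<^sup>-\<^sup>1\<close> satisfy
  \<open>dH = m H (G (a) \<delta> G (a)\<^sup>-\<^sup>1)\<close>, and \<open>K\<close> is the limit of \<open>(H - I) / m\<close>.\<close>

lemma spectral_derivative:
  "\<exists>K. K 0 = 0 \<and> (\<forall>u\<in>U. (K has_derivative
    (\<lambda>v. G a u ** (diag_mat v ** transpose (G (- a) u)))) (at u))"
proof -
  define m where "m k = inverse (real (Suc k))" for k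
  define A where "A u v W = W ** (G a u ** (diag_mat v ** transpose (G (- a) u)))"
    for u v and W :: "real^'n^'n"
  obtain M where M: "M \<ge> 0" "\<And>(P :: real^'n^'n) (Q :: real^'n^'n). norm (P ** Q) \<le> norm P * norm Q * M"
    using bounded_bilinear.nonneg_bounded[OF bounded_bilinear_matrix_mult] by blast
  obtain N where N: "N \<ge> 0" "\<And>v :: real^'n. norm (diag_mat v) \<le> norm v * N"
    using bounded_linear.nonneg_bounded[OF bounded_linear_diag_mat] by blast
  have "\<exists>K. K 0 = 0 \<and> (\<forall>u\<in>U. (K has_derivative (\<lambda>v. A u v (mat 1))) (at u))"
  proof (rule difference_quotient_limit[OF open_U connected_U zero_in_U])
    show "((\<lambda>u. G (a + m k) u ** transpose (G (- a) u)) has_derivative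
        (\<lambda>v. m k *\<^sub>R A u v (G (a + m k) u ** transpose (G (- a) u)))) (at u)" if "u \<in> U" for k u
    proof -
      have "G (a + m k) u ** (transpose (G (- a) u) ** (G a u ** W)) = G (a + m k) u ** W" for W :: "real^'n^'n"
        by (metis frame_inverse(2)[OF that] matrix_mul_assoc matrix_mul_lid)
      then show ?thesis
        using matrix_mult_has_derivative[OF frame_has_derivative[OF that]
            frame_transpose_has_derivative[OF that], of "a + m k" "- a"]
        by (simp add: A_def matrix_ring_simps algebra_simps)
    qed
    show "G (a + m k) 0 ** transpose (G (- a) 0) = mat 1" for k by (simp add: frame_0)
    show "m \<longlonglongrightarrow> 0" unfolding m_def[abs_def] by (rule LIMSEQ_inverse_real_of_nat)
    show "m k \<noteq> 0" for k by (simp add: m_def)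
    show "linear (A u v)" for u v
      unfolding A_def by (rule linearI) (simp_all add: matrix_mult_linear_simps)
    show "norm (A u v W) \<le> (norm (G a u) * norm (transpose (G (- a) u)) * M * M * M * N) * norm v * norm W"
      for u v W
    proof -
      have "norm (A u v W) \<le> norm W * norm (G a u ** (diag_mat v ** transpose (G (- a) u))) * M"
        unfolding A_def by (rule M(2))
      also have "\<dots> \<le> norm W * (norm (G a u) * norm (diag_mat v ** transpose (G (- a) u)) * M) * M"
        by (intro mult_right_mono mult_left_mono M) auto
      also have "\<dots> \<le> norm W * (norm (G a u) * (norm (diag_mat v) * norm (transpose (G (- a) u)) * M) * M) * M"
        by (intro mult_right_mono mult_left_mono M) auto
      also have "\<dots> \<le> norm W * (norm (G a u) * ((norm v * N) * norm (transpose (G (- a) u)) * M) * M) * M"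
        by (intro mult_right_mono mult_left_mono M N) (auto intro: M)
      finally show ?thesis by (simp add: mult_ac)
    qed
    have "continuous_on U (G s)" "continuous_on U (\<lambda>u. transpose (G s u))" for s
      using has_derivative_continuous_on[OF has_derivative_at_withinI[OF frame_has_derivative]]
        has_derivative_continuous_on[OF has_derivative_at_withinI[OF frame_transpose_has_derivative]]
      by blast+
    then show "continuous_on U (\<lambda>u. norm (G a u) * norm (transpose (G (- a) u)) * M * M * M * N)"
      by (intro continuous_intros)
  qed
  then show ?thesis by (simp add: A_def matrix_ring_simps)
qed

end

section \<open>Solving the system\<close>

definition real_system ::
    "(real^'n) set \<Rightarrow> (real^'n \<Rightarrow> real^'n) \<Rightarrow> (real^'n \<Rightarrow> real^'n^'n) \<Rightarrow> real
     \<Rightarrow> real^'n^'n \<Rightarrow> real^'n \<Rightarrow> (real^'n \<Rightarrow> real^'n^'n) \<Rightarrow> (real^'n \<Rightarrow> real^'n) \<Rightarrow> bool" where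
  "real_system U h \<beta> a \<pi>0 b Q y \<longleftrightarrow>
     (\<forall>u\<in>U. (Q has_derivative (\<lambda>v.
          - (mcomm (mcomm (diag_mat v) (\<beta> u)) (Q u)
             + a *\<^sub>R (mcomm (diag_mat v) (Q u) ** (mat 1 - 2 *\<^sub>R Q u))))) (at u))
   \<and> Q 0 = \<pi>0
   \<and> (\<forall>u\<in>U. (y has_derivative (\<lambda>v.
          - (mcomm (diag_mat v) (\<beta> u - (2 * a) *\<^sub>R Q u) *v y u)
          + Q u *v (diag_mat v *v h u) - a *\<^sub>R (diag_mat v *v y u))) (at u))
   \<and> y 0 = b
   \<and> (\<forall>u\<in>U. Q u ** Q u = Q u \<and> transpose (Q u) = Q u)"

text \<open>The columns of \<open>A\<close> and \<open>C\<close> span complementary orthogonal subspaces.  The matrix \<open>Q\<close> is the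
  projection onto the first along the second, hence an orthogonal projection, written without
  choosing bases.\<close>

lemma oblique_projection:
  fixes A C P :: "real^'n^'n"
  assumes B: "invertible (A + C)" and A: "A ** P = A" and C: "C ** P = 0"
    and orth: "transpose A ** C = 0"
  defines "Q \<equiv> A ** matrix_inv (A + C)"
  shows "Q ** A = A" "Q ** C = 0" "Q ** Q = Q" "transpose Q = Q"
proof -
  have QB: "Q ** (A + C) = A"
    unfolding Q_def by (simp add: matrix_mul_assoc[symmetric] matrix_inv_cancel[OF B])
  have "Q ** A = Q ** ((A + C) ** P)" by (simp add: matrix_mult_linear_simps A C)
  also have "\<dots> = A" by (simp add: matrix_mul_assoc QB A)
  finally show QA: "Q ** A = A" .
  show QC: "Q ** C = 0" using QB by (simp add: matrix_mult_linear_simps QA)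
  have "transpose C ** A = transpose (transpose A ** C)" by (simp add: matrix_transpose_mul)
  moreover have "transpose (0 :: real^'n^'n) = 0" by (simp add: vec_eq_iff transpose_def)
  ultimately have orth': "transpose C ** A = 0" by (simp add: orth)
  have "transpose (A + C) ** (transpose Q ** Q) ** (A + C) = transpose (Q ** (A + C)) ** (Q ** (A + C))"
    by (simp add: matrix_transpose_mul matrix_mul_assoc)
  also have "\<dots> = transpose (A + C) ** A"
    by (simp only: QB) (simp add: transpose_linear_simps matrix_mult_linear_simps orth')
  also have "\<dots> = transpose (A + C) ** Q ** (A + C)"
    by (simp add: QB matrix_mul_assoc[symmetric])
  finally have eq: "transpose (A + C) ** (transpose Q ** Q) ** (A + C) = transpose (A + C) ** Q ** (A + C)" .
  have cancel: "X = Y" if "transpose (A + C) ** X ** (A + C) = transpose (A + C) ** Y ** (A + C)" for X Y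
  proof -
    obtain D where D: "(A + C) ** D = mat 1" "D ** (A + C) = mat 1"
      using B unfolding invertible_def by blast
    then have tD: "transpose D ** transpose (A + C) = mat 1"
      by (metis matrix_transpose_mul transpose_mat)
    have "X = transpose D ** (transpose (A + C) ** X ** (A + C)) ** D" for X
      using D tD by (metis matrix_mul_assoc matrix_mul_lid matrix_mul_rid)
    then show ?thesis using that by metis
  qed
  have QtQ: "transpose Q ** Q = Q" by (rule cancel[OF eq])
  show "transpose Q = Q" by (metis QtQ matrix_transpose_mul transpose_transpose)
  then show "Q ** Q = Q" using QtQ by simp
qed

context lax_frames
begin

lemma frame_injective:
  assumes "u \<in> U" "transpose (G s u) *v w = 0"
  shows "w = 0"
proof -
  have "G (- s) u *v (transpose (G s u) *v w) = w"
    using frame_inverse(1)[OF assms(1), of "- s"] by (simp add: matrix_vector_mul_assoc)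
  then show ?thesis using assms(2) by (simp add: matrix_vector_linear_simps)
qed

text \<open>The equation for \<open>Q\<close> says that its image and its kernel move by the linear equations with
  coefficients \<open>a \<delta> - [\<delta>, \<beta>]\<close> and \<open>- a \<delta> - [\<delta>, \<beta>]\<close>, which the transposes of \<open>G a\<close> and \<open>G (- a)\<close> solve.
  So \<open>Q\<close> is the projection onto the image of \<open>G (a)\<^sup>t \<pi>0\<close>, which is orthogonal to the image of
  \<open>G (- a)\<^sup>t (I - \<pi>0)\<close> by \<open>frame_inverse\<close>.  The kernel component of \<open>y\<close> solves a homogeneous linear
  equation, so it is \<open>z = G (- a)\<^sup>t (I - \<pi>0) b\<close>.  For the image component the ansatz \<open>Q G (- a)\<^sup>t p\<close>
  leads to \<open>dp = G (a) \<delta> (h - 2 a z)\<close>, which is solved by means of the position vector \<open>x a\<close> and the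
  spectral derivative \<open>K\<close>.\<close>

theorem real_system_solvable:
  assumes \<pi>0: "\<pi>0 ** \<pi>0 = \<pi>0" "transpose \<pi>0 = \<pi>0"
  shows "\<exists>Q y. real_system U h \<beta> a \<pi>0 b Q y"
proof -
  define \<pi>1 where "\<pi>1 = mat 1 - \<pi>0"
  have \<pi>1: "\<pi>0 ** \<pi>1 = 0" "\<pi>1 ** \<pi>0 = 0" "\<pi>0 + \<pi>1 = mat 1" "transpose \<pi>1 = \<pi>1"
    by (simp_all add: \<pi>1_def matrix_ring_simps \<pi>0 transpose_linear_simps)
  define A where "A u = transpose (G a u) ** \<pi>0" for u
  define C where "C u = transpose (G (- a) u) ** \<pi>1" for u
  define Q where "Q u = A u ** matrix_inv (A u + C u)" for u
  have orth: "transpose (A u) ** C u = 0" if "u \<in> U" for u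
  proof -
    have "transpose (A u) ** C u = \<pi>0 ** ((G a u ** transpose (G (- a) u)) ** \<pi>1)"
      by (simp add: A_def C_def matrix_transpose_mul \<pi>0 matrix_mul_assoc)
    then show ?thesis by (simp add: frame_inverse[OF that] \<pi>1)
  qed
  \<comment> \<open>If \<open>(A + C) w = 0\<close>, then the orthogonal vectors \<open>A w\<close> and \<open>C w\<close> both vanish.\<close>
  have inv: "invertible (A u + C u)" if "u \<in> U" for u
  proof -
    have "w = 0" if w: "(A u + C u) *v w = 0" for w
    proof -
      have sum0: "A u *v w + C u *v w = 0" using w by (simp add: matrix_vector_linear_simps)
      have "(A u *v w) \<bullet> (C u *v w) = w \<bullet> (transpose (A u) ** C u *v w)"
        using inner_transpose_matrix[of "A u" "C u *v w" w]
        by (simp add: inner_commute matrix_vector_mul_assoc)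
      then have "(A u *v w) \<bullet> (C u *v w) = 0"
        by (simp add: orth[OF \<open>u \<in> U\<close>] matrix_vector_linear_simps)
      then have "A u *v w = 0" "C u *v w = 0"
        using sum0 by (metis add_eq_0_iff inner_eq_zero_iff inner_minus_right neg_equal_0_iff_equal)+
      then have "\<pi>0 *v w = 0" "\<pi>1 *v w = 0"
        using frame_injective[OF \<open>u \<in> U\<close>]
        by (simp_all add: A_def C_def matrix_vector_mul_assoc[symmetric])
      then have "(\<pi>0 + \<pi>1) *v w = 0" by (simp add: matrix_vector_linear_simps)
      then show "w = 0" by (simp add: \<pi>1)
    qed
    then show ?thesis
      using matrix_left_invertible_ker matrix_left_right_inverse unfolding invertible_def by metis
  qed
  have Q: "Q u ** A u = A u" "Q u ** C u = 0" "Q u ** Q u = Q u" "transpose (Q u) = Q u"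
    if "u \<in> U" for u
    using oblique_projection[OF inv[OF that] _ _ orth[OF that], of \<pi>0]
    by (simp_all add: Q_def A_def C_def matrix_mul_assoc[symmetric] \<pi>0 \<pi>1 matrix_mult_linear_simps)
  let ?\<omega> = "\<lambda>u v. mcomm (diag_mat v) (\<beta> u)"
  have dA: "(A has_derivative (\<lambda>v. (a *\<^sub>R diag_mat v - ?\<omega> u v) ** A u)) (at u)" if "u \<in> U" for u
    using matrix_mult_has_derivative[OF frame_transpose_has_derivative[OF that, of a]
        has_derivative_const[of \<pi>0]]
    by (simp add: A_def[abs_def] matrix_ring_simps)
  have dC: "(C has_derivative (\<lambda>v. (- a *\<^sub>R diag_mat v - ?\<omega> u v) ** C u)) (at u)" if "u \<in> U" for u
    using matrix_mult_has_derivative[OF frame_transpose_has_derivative[OF that, of "- a"]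
        has_derivative_const[of \<pi>1]]
    by (simp add: C_def[abs_def] matrix_ring_simps)
  have dQ: "(Q has_derivative (\<lambda>v. - (mcomm (?\<omega> u v) (Q u)
      + a *\<^sub>R (mcomm (diag_mat v) (Q u) ** (mat 1 - 2 *\<^sub>R Q u))))) (at u)" if u: "u \<in> U" for u
  proof -
    have "(\<lambda>u. A u + C u) differentiable (at u)"
      using has_derivative_add[OF dA[OF u] dC[OF u]] unfolding differentiable_def by blast
    from matrix_inv_differentiable[OF this open_U u inv]
    obtain I' where "((\<lambda>u. matrix_inv (A u + C u)) has_derivative I') (at u)"
      unfolding differentiable_def by blast
    from matrix_mult_has_derivative[OF dA[OF u] this]
    obtain Q' where Q': "(Q has_derivative Q') (at u)"
      unfolding Q_def[abs_def] by blast
    have "(A has_derivative (\<lambda>v. Q u ** ((a *\<^sub>R diag_mat v - ?\<omega> u v) ** A u + (- a *\<^sub>R diag_mat v - ?\<omega> u v) ** C u)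
        + Q' v ** (A u + C u))) (at u)"
      by (rule has_derivative_transform_within_open[OF
            matrix_mult_has_derivative[OF Q' has_derivative_add[OF dA[OF u] dC[OF u]]] open_U u])
        (simp add: matrix_mult_linear_simps Q)
    from has_derivative_unique[OF this dA[OF u]]
    have Q'B: "Q' v ** (A u + C u) = (a *\<^sub>R diag_mat v - ?\<omega> u v) ** A u
        - Q u ** ((a *\<^sub>R diag_mat v - ?\<omega> u v) ** A u + (- a *\<^sub>R diag_mat v - ?\<omega> u v) ** C u)" for v
      by (simp add: fun_eq_iff algebra_simps)
    \<comment> \<open>Both sides agree after multiplication by the invertible matrix \<open>A + C\<close>, since \<open>Q A = A\<close> and
      \<open>Q C = 0\<close>.\<close>
    have "Q' v = - (mcomm (?\<omega> u v) (Q u)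
      + a *\<^sub>R (mcomm (diag_mat v) (Q u) ** (mat 1 - 2 *\<^sub>R Q u)))" (is "_ = ?R v") for v
    proof -
      define D B q c d where "D = diag_mat v" and "B = \<beta> u" and "q = Q u" and "c = A u" and "d = C u"
      have q: "q ** c = c" "q ** d = 0" "q ** (q ** X) = q ** X" "q ** q = q" for X :: "real^'n^'n"
        using Q[OF u] by (simp_all add: q_def c_def d_def matrix_mul_assoc)
      have "?R v ** (A u + C u) = Q' v ** (A u + C u)"
        unfolding Q'B
        by (simp add: mcomm_def matrix_ring_simps q flip: D_def B_def q_def c_def d_def)
          (simp add: vec_eq_iff algebra_simps)
      then have "?R v ** (A u + C u) ** matrix_inv (A u + C u) = Q' v ** (A u + C u) ** matrix_inv (A u + C u)"
        by simp
      then show ?thesis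
        by (simp add: matrix_mul_assoc[symmetric] matrix_inv_cancel[OF inv[OF u]])
    qed
    then have "Q' = (\<lambda>v. ?R v)" by blast
    then show ?thesis using Q' by simp
  qed
  obtain K where K0: "K 0 = 0" and K: "\<And>u. u \<in> U \<Longrightarrow>
      (K has_derivative (\<lambda>v. G a u ** (diag_mat v ** transpose (G (- a) u)))) (at u)"
    using spectral_derivative[of a] by blast
  define z where "z u = transpose (G (- a) u) *v (\<pi>1 *v b)" for u
  define p where "p u = \<pi>0 *v b + x a u - (2 * a) *\<^sub>R (K u *v (\<pi>1 *v b))" for u
  define q where "q u = transpose (G (- a) u) *v p u" for u
  define y where "y u = z u + Q u *v q u" for u
  have Qz: "Q u *v z u = 0" if "u \<in> U" for u
  proof -
    have "Q u *v z u = (Q u ** C u) *v b"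
      by (simp add: z_def C_def matrix_vector_mul_assoc matrix_mul_assoc)
    then show ?thesis by (simp add: Q[OF that] matrix_vector_linear_simps)
  qed
  have dz: "(z has_derivative (\<lambda>v. (- a *\<^sub>R diag_mat v - ?\<omega> u v) *v z u)) (at u)" if "u \<in> U" for u
    using matrix_vector_has_derivative[OF frame_transpose_has_derivative[OF that, of "- a"]
        has_derivative_const[of "\<pi>1 *v b"]]
    by (simp add: z_def[abs_def] matrix_vector_simps)
  have dp: "(p has_derivative (\<lambda>v. G a u *v (diag_mat v *v h u)
      - (2 * a) *\<^sub>R (G a u *v (diag_mat v *v z u)))) (at u)" if "u \<in> U" for u
    unfolding p_def[abs_def]
    by (rule has_derivative_eq_rhs, rule has_derivative_diff,
        rule has_derivative_add[OF has_derivative_const position_has_derivative[OF that]],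
        rule has_derivative_scaleR_right,
        rule matrix_vector_has_derivative[OF K[OF that] has_derivative_const])
      (simp add: z_def matrix_vector_simps)
  have dq: "(q has_derivative (\<lambda>v. (- a *\<^sub>R diag_mat v - ?\<omega> u v) *v q u
      + diag_mat v *v h u - (2 * a) *\<^sub>R (diag_mat v *v z u))) (at u)" if "u \<in> U" for u
  proof -
    have "transpose (G (- a) u) *v (G a u *v w) = w" for w
      by (simp add: matrix_vector_mul_assoc frame_inverse[OF that])
    then show ?thesis
      using matrix_vector_has_derivative[OF frame_transpose_has_derivative[OF that] dp[OF that], of "- a"]
      by (simp add: q_def[abs_def] matrix_vector_simps algebra_simps)
  qed
  have dy: "(y has_derivative (\<lambda>v. - (mcomm (diag_mat v) (\<beta> u - (2 * a) *\<^sub>R Q u) *v y u)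
          + Q u *v (diag_mat v *v h u) - a *\<^sub>R (diag_mat v *v y u))) (at u)" if u: "u \<in> U" for u
  proof -
    define D B r zz qq where "D v = diag_mat v" and "B = \<beta> u" and "r = Q u" and "zz = z u" and "qq = q u" for v :: "real^'n"
    have r: "r *v zz = 0" "r *v (r *v w) = r *v w" "r ** r = r" "r ** (r ** X) = r ** X" for w and X :: "real^'n^'n"
      using Q(3)[OF u] Qz[OF u] by (simp_all add: r_def zz_def matrix_vector_mul_assoc matrix_mul_assoc)
    show ?thesis
      unfolding y_def[abs_def]
      by (rule has_derivative_eq_rhs,
          rule has_derivative_add[OF dz[OF u] matrix_vector_has_derivative[OF dQ[OF u] dq[OF u]]])
        (simp add: fun_eq_iff mcomm_def r matrix_vector_simps flip: D_def B_def r_def zz_def qq_def,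
         simp add: vec_eq_iff algebra_simps)
  qed
  have "Q 0 = \<pi>0"
    by (simp add: Q_def A_def C_def frame_0 \<pi>1 matrix_ring_simps
        matrix_inv_eqI[of "mat 1" "mat 1", OF matrix_mul_lid])
  moreover have "y 0 = b"
    using \<pi>1(3) \<open>Q 0 = \<pi>0\<close>
    by (simp add: y_def z_def q_def p_def frame_0 K0 position_0 matrix_vector_linear_simps
        matrix_vector_mul_assoc \<pi>0 add.commute flip: matrix_vector_mult_add_rdistrib)
  ultimately show ?thesis
    unfolding real_system_def using dQ dy Q(3,4) by blast
qed

end

section \<open>The transformed metric\<close>

lemma Ck_on_minus: "open U \<Longrightarrow> Ck_on k U f \<Longrightarrow> Ck_on k U (\<lambda>x. - f x)"
  by (rule Ck_on_bounded_linear[OF bounded_linear_minus[OF bounded_linear_ident]])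

lemma Ck_on_diff: "open U \<Longrightarrow> Ck_on k U f \<Longrightarrow> Ck_on k U g \<Longrightarrow> Ck_on k U (\<lambda>x. f x - g x)"
  using Ck_on_add[OF _ _ Ck_on_minus, of U k f g] by simp

lemma Ck_on_scaleR_const: "open U \<Longrightarrow> Ck_on k U f \<Longrightarrow> Ck_on k U (\<lambda>x. c *\<^sub>R f x)"
  by (rule Ck_on_bounded_linear[OF bounded_linear_scaleR_right])

lemmas Ck_on_intros = Ck_on_const Ck_on_add Ck_on_minus Ck_on_diff Ck_on_scaleR_const
  Ck_on_bilinear[OF bounded_bilinear_matrix_mult] Ck_on_bilinear[OF bounded_bilinear_matrix_vector_mult]

lemma smooth_on_diff: "open U \<Longrightarrow> smooth_on U f \<Longrightarrow> smooth_on U g \<Longrightarrow> smooth_on U (\<lambda>x. f x - g x)"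
  by (simp add: smooth_on_def Ck_on_diff)

lemma smooth_on_scaleR_const: "open U \<Longrightarrow> smooth_on U f \<Longrightarrow> smooth_on U (\<lambda>x. c *\<^sub>R f x)"
  by (simp add: smooth_on_def Ck_on_scaleR_const)

lemma sum_delta_mult:
  fixes w :: "'n::finite \<Rightarrow> real"
  shows "(\<Sum>k\<in>UNIV. (if i = k then c k else 0) * w k) = c i * w i"
    "(\<Sum>k\<in>UNIV. w k * (if k = i then c k else 0)) = w i * c i"
proof -
  have "(\<Sum>k\<in>UNIV. (if i = k then c k else 0) * w k) = (\<Sum>k\<in>UNIV. if i = k then c k * w k else 0)"
    by (rule sum.cong) simp_all
  moreover have "(\<Sum>k\<in>UNIV. w k * (if k = i then c k else 0)) = (\<Sum>k\<in>UNIV. if k = i then w k * c k else 0)"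
    by (rule sum.cong) simp_all
  ultimately show "(\<Sum>k\<in>UNIV. (if i = k then c k else 0) * w k) = c i * w i"
    "(\<Sum>k\<in>UNIV. w k * (if k = i then c k else 0)) = w i * c i"
    by simp_all
qed

lemma matrix_mult_axis_nth: "((B :: real^'n^'m) *v axis j c) $ i = B $ i $ j * c"
  by (simp add: matrix_vector_mult_def axis_def sum_delta_mult)

lemma diag_mat_mult_nth:
  fixes B :: "real^'n^'n"
  shows "(diag_mat v ** B) $ i $ k = v $ i * B $ i $ k" "(B ** diag_mat v) $ i $ k = B $ i $ k * v $ k"
    "(diag_mat v *v w) $ i = v $ i * w $ i"
  by (simp_all add: diag_mat_def matrix_matrix_mult_def matrix_vector_mult_def sum_delta_mult)

lemma diag_mat_axis_mult_vector: "diag_mat (axis i 1) *v w = axis i (w $ i :: real)"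
  by (auto simp: vec_eq_iff diag_mat_mult_nth axis_def)

lemma mcomm_axis_mult_nth:
  assumes "i \<noteq> j"
  shows "(mcomm (diag_mat (axis j 1)) B *v w) $ i = - (B $ i $ j * w $ j)"
proof -
  have "(diag_mat (axis j 1) *v (B *v w)) $ i = 0"
    using assms by (simp add: diag_mat_mult_nth axis_def)
  then show ?thesis
    by (simp add: mcomm_def matrix_vector_simps diag_mat_axis_mult_vector matrix_mult_axis_nth)
qed

lemma mcomm_axis_mult_axis:
  fixes B :: "real^'n^'n"
  assumes "i \<noteq> j"
  shows "mcomm (diag_mat (axis i 1)) B *v axis j 1 = B $ i $ j *\<^sub>R axis i 1"
proof -
  have "(B *v axis j 1) $ i = B $ i $ j"
    by (simp add: matrix_vector_mult_basis column_def)
  then have "diag_mat (axis i 1) *v (B *v axis j 1) = B $ i $ j *\<^sub>R axis i 1"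
    by (simp add: diag_mat_axis_mult_vector) (simp add: axis_def vec_eq_iff)
  moreover have "diag_mat (axis i 1) *v axis j 1 = (0 :: real^'n)"
    using assms by (auto simp: vec_eq_iff diag_mat_mult_nth axis_def)
  ultimately show ?thesis by (simp add: mcomm_def matrix_vector_simps)
qed

lemma inner_mcomm_self:
  assumes "transpose B = B"
  shows "w \<bullet> (mcomm (diag_mat v) B *v w) = 0"
  using inner_transpose_matrix[of "mcomm (diag_mat v) B" w w]
  by (simp add: transpose_mcomm[OF assms] matrix_vector_linear_simps inner_commute)

lemma (in lax_frames) frame_Ck_on:
  assumes "smooth_on U \<beta>"
  shows "Ck_on k U (G s)"
proof (induction k)
  case 0
  show ?case
    using has_derivative_continuous_on[OF has_derivative_at_withinI[OF frame_has_derivative]] by simp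
next
  case (Suc k)
  show ?case
    by (rule Ck_on_SucI[OF open_U frame_has_derivative])
      (use Suc assms open_U in \<open>auto simp: smooth_on_def mcomm_def intro!: Ck_on_intros\<close>)
qed

locale transformed_egoroff = lax_frames +
  fixes \<phi> :: "real^'n \<Rightarrow> real" and a :: real and \<pi>0 :: "real^'n^'n" and b :: "real^'n"
    and Q :: "real^'n \<Rightarrow> real^'n^'n" and y :: "real^'n \<Rightarrow> real^'n"
  assumes smooth_h: "smooth_on U h" and smooth_\<beta>: "smooth_on U \<beta>"
    and rotation: "\<And>u i j. u \<in> U \<Longrightarrow> i \<noteq> j \<Longrightarrow> partial j (\<lambda>x. h x $ i) u = \<beta> u $ i $ j * h u $ j"
    and potential: "egoroff_potential_on U h \<phi>"
    and system: "real_system U h \<beta> a \<pi>0 b Q y"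
begin

definition h' :: "real^'n \<Rightarrow> real^'n" where "h' u = h u - (2 * a) *\<^sub>R y u"

text \<open>The full matrix \<open>\<beta> - 2 a Q\<close>: its diagonal drops out of \<open>[\<delta>, \<beta>']\<close>, and off the diagonal it
  is the new rotation coefficient matrix.\<close>

definition \<beta>' :: "real^'n \<Rightarrow> real^'n^'n" where "\<beta>' u = \<beta> u - (2 * a) *\<^sub>R Q u"

lemma projection_has_derivative:
  "u \<in> U \<Longrightarrow> (Q has_derivative (\<lambda>v. - (mcomm (mcomm (diag_mat v) (\<beta> u)) (Q u)
      + a *\<^sub>R (mcomm (diag_mat v) (Q u) ** (mat 1 - 2 *\<^sub>R Q u))))) (at u)"
  and y_has_derivative:
  "u \<in> U \<Longrightarrow> (y has_derivative (\<lambda>v. - (mcomm (diag_mat v) (\<beta>' u) *v y u)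
      + Q u *v (diag_mat v *v h u) - a *\<^sub>R (diag_mat v *v y u))) (at u)"
  and projection: "u \<in> U \<Longrightarrow> Q u ** Q u = Q u" "u \<in> U \<Longrightarrow> transpose (Q u) = Q u"
  and initial: "Q 0 = \<pi>0" "y 0 = b"
  using system unfolding real_system_def \<beta>'_def by blast+

lemma \<beta>'_sym: "u \<in> U \<Longrightarrow> transpose (\<beta>' u) = \<beta>' u"
  by (simp add: \<beta>'_def transpose_linear_simps \<beta>_sym projection)

text \<open>The right hand sides of the system are polynomials in \<open>Q\<close>, \<open>y\<close> and the smooth data, so
  each derivative of the solution yields the next one.\<close>

lemma solution_Ck_on: "Ck_on k U Q \<and> Ck_on k U y"
proof (induction k)
  case 0
  show ?case
    using has_derivative_continuous_on[OF has_derivative_at_withinI[OF projection_has_derivative]]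
      has_derivative_continuous_on[OF has_derivative_at_withinI[OF y_has_derivative]] by simp
next
  case (Suc k)
  have data: "Ck_on k U h" "Ck_on k U \<beta>" using smooth_h smooth_\<beta> by (simp_all add: smooth_on_def)
  have "Ck_on (Suc k) U Q"
    by (rule Ck_on_SucI[OF open_U projection_has_derivative])
      (use Suc data open_U in \<open>auto simp: mcomm_def intro!: Ck_on_intros\<close>)
  moreover have "Ck_on (Suc k) U y"
    by (rule Ck_on_SucI[OF open_U y_has_derivative])
      (use Suc data open_U in \<open>auto simp: mcomm_def \<beta>'_def intro!: Ck_on_intros\<close>)
  ultimately show ?case ..
qed

lemma smooth_solution: "smooth_on U Q" "smooth_on U y"
  using solution_Ck_on by (simp_all add: smooth_on_def)

lemma smooth_h': "smooth_on U h'"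
  unfolding h'_def[abs_def]
  by (rule smooth_on_diff[OF open_U smooth_h smooth_on_scaleR_const[OF open_U smooth_solution(2)]])

lemma rotation':
  assumes "u \<in> U" "i \<noteq> j"
  shows "partial j (\<lambda>x. h' x $ i) u = \<beta>' u $ i $ j * h' u $ j"
proof -
  have "partial j h' u = partial j h u - (2 * a) *\<^sub>R partial j y u"
    unfolding h'_def[abs_def]
    using partial_eqI[OF has_derivative_diff[OF smooth_on_has_derivative[OF open_U smooth_h assms(1)]
        has_derivative_scaleR_right[OF smooth_on_has_derivative[OF open_U smooth_solution(2) assms(1)]]]]
    by (simp add: partial_def)
  moreover have "partial j y u $ i = \<beta>' u $ i $ j * y u $ j + Q u $ i $ j * h u $ j"
    using assms(2)
    by (simp add: partial_eqI[OF y_has_derivative[OF assms(1)]] mcomm_axis_mult_nth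
        diag_mat_axis_mult_vector matrix_mult_axis_nth)
      (simp add: axis_def)
  moreover have "partial j h u $ i = \<beta> u $ i $ j * h u $ j"
    using rotation[OF assms] by (simp add: partial_vec_nth[OF open_U smooth_h assms(1)])
  ultimately show ?thesis
    by (simp add: partial_vec_nth[OF open_U smooth_h' assms(1)] \<beta>'_def)
      (simp add: h'_def algebra_simps)
qed

text \<open>The two equations of the system combine to \<open>dz = - ([\<delta>, \<beta>] + a \<delta>) z\<close> for \<open>z = y - Q y\<close>, so that
  \<open>G (a) z\<close> is constant.\<close>

lemma kernel_component:
  assumes "u \<in> U"
  shows "y u - Q u *v y u = transpose (G (- a) u) *v (b - \<pi>0 *v b)"
proof -
  define z where "z u = y u - Q u *v y u" for u
  have "((\<lambda>u. G a u *v z u) has_derivative (\<lambda>v. 0)) (at u)" if u: "u \<in> U" for u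
  proof -
    have dz: "(z has_derivative (\<lambda>v. - (mcomm (diag_mat v) (\<beta> u) *v z u) - a *\<^sub>R (diag_mat v *v z u))) (at u)"
    proof -
      define D B r w where "D v = diag_mat v" and "B = \<beta> u" and "r = Q u" and "w = y u" for v :: "real^'n"
      have r: "r ** r = r" "r ** (r ** X) = r ** X" "r *v (r *v c) = r *v c" for c and X :: "real^'n^'n"
        using projection(1)[OF u] by (simp_all add: r_def matrix_vector_mul_assoc matrix_mul_assoc)
      show ?thesis
        unfolding z_def[abs_def]
        by (rule has_derivative_eq_rhs,
            rule has_derivative_diff[OF y_has_derivative[OF u]
              matrix_vector_has_derivative[OF projection_has_derivative[OF u] y_has_derivative[OF u]]])
          (simp add: fun_eq_iff mcomm_def \<beta>'_def r matrix_vector_simps flip: D_def B_def r_def w_def,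
           simp add: vec_eq_iff algebra_simps)
    qed
    show ?thesis
      by (rule has_derivative_eq_rhs,
          rule matrix_vector_has_derivative[OF frame_has_derivative[OF u] dz])
        (simp add: fun_eq_iff matrix_vector_simps)
  qed
  from constant_of_zero_derivative[OF this assms]
  have "G a u *v z u = b - \<pi>0 *v b" by (simp add: z_def frame_0 initial)
  then have "transpose (G (- a) u) *v (b - \<pi>0 *v b) = z u"
    by (metis frame_inverse(2)[OF assms] matrix_vector_mul_assoc matrix_vector_mul_lid)
  then show ?thesis by (simp add: z_def)
qed

text \<open>Since \<open>h'\<^sub>i\<^sup>2 - h\<^sub>i\<^sup>2 = - 4 a (h\<^sub>i y\<^sub>i - a y\<^sub>i\<^sup>2)\<close>, a primitive of \<open>h\<^sup>t \<delta> y - a y\<^sup>t \<delta> y\<close> is wanted.  The terms of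
  \<open>dy\<close> that are skew-symmetric matrices applied to \<open>y\<close> do not contribute to
  \<open>d \<bar>y\<bar>\<^sup>2 / 2 = h\<^sup>t \<delta> Q y - a y\<^sup>t \<delta> y\<close>.  What is missing is \<open>h\<^sup>t \<delta> z\<close> for the kernel component
  \<open>z = y - Q y\<close>, and \<open>kernel_component\<close> identifies it as the differential of
  \<open>x (- a) \<bullet> (b - \<pi>0 b)\<close>.\<close>

lemma potential': "\<exists>\<phi>'. egoroff_potential_on U h' \<phi>'"
proof -
  define c where "c = b - \<pi>0 *v b"
  define \<phi>' where "\<phi>' u = \<phi> u - (4 * a) * (1 / 2 * (y u \<bullet> y u) + x (- a) u \<bullet> c)" for u
  have smooth_\<phi>: "smooth_on U \<phi>" and d\<phi>: "\<And>u i. u \<in> U \<Longrightarrow> partial i \<phi> u = (h u $ i)\<^sup>2"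
    using potential by (auto simp: egoroff_potential_on_def)
  let ?y' = "\<lambda>u v. - (mcomm (diag_mat v) (\<beta>' u) *v y u)
      + Q u *v (diag_mat v *v h u) - a *\<^sub>R (diag_mat v *v y u)"
  define f' where "f' u v = frechet_derivative \<phi> (at u) v
      - (4 * a) * (y u \<bullet> ?y' u v + (G (- a) u *v (diag_mat v *v h u)) \<bullet> c)" for u v
  have d: "(\<phi>' has_derivative f' u) (at u)" if u: "u \<in> U" for u
    unfolding \<phi>'_def[abs_def] f'_def[abs_def]
    by (rule has_derivative_eq_rhs,
        rule has_derivative_diff[OF smooth_on_has_derivative[OF open_U smooth_\<phi> u]
          has_derivative_mult_right[OF has_derivative_add[OF
            has_derivative_mult_right[OF has_derivative_inner[OF y_has_derivative[OF u] y_has_derivative[OF u]], of "1 / 2"]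
            has_derivative_inner_left[OF position_has_derivative[OF u]]]]])
      (simp add: fun_eq_iff inner_commute)
  have val: "f' u (axis i 1) = (h' u $ i)\<^sup>2" if u: "u \<in> U" for u i
  proof -
    let ?w = "diag_mat (axis i 1) *v h u"
    have "y u \<bullet> (Q u *v ?w) = (Q u *v y u) \<bullet> ?w"
      using inner_transpose_matrix[of "Q u" "y u" ?w] projection(2)[OF u] by simp
    moreover have "(G (- a) u *v ?w) \<bullet> c = ?w \<bullet> (y u - Q u *v y u)"
      using inner_transpose_matrix[of "G (- a) u" c ?w] kernel_component[OF u] by (simp add: c_def inner_commute)
    ultimately have "y u \<bullet> ?y' u (axis i 1) + (G (- a) u *v ?w) \<bullet> c
        = y u \<bullet> ?w - a * (y u \<bullet> (diag_mat (axis i 1) *v y u))"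
      using inner_mcomm_self[OF \<beta>'_sym[OF u], of "y u" "axis i 1"]
      by (simp add: inner_diff_right inner_add_right inner_commute)
    also have "\<dots> = y u $ i * h u $ i - a * (y u $ i)\<^sup>2"
      by (simp add: diag_mat_axis_mult_vector inner_axis power2_eq_square)
    finally have "f' u (axis i 1) = (h u $ i)\<^sup>2 - (4 * a) * (y u $ i * h u $ i - a * (y u $ i)\<^sup>2)"
      using d\<phi>[OF u, of i] by (simp only: f'_def partial_def)
    then show ?thesis
      by (simp add: h'_def power2_eq_square algebra_simps)
  qed
  have "smooth_on U \<phi>'"
  proof (rule smooth_onI[OF open_U d])
    fix i
    have hi: "smooth_on U (\<lambda>u. h' u $ i)"
      by (rule smooth_on_bounded_linear[OF bounded_linear_vec_nth open_U smooth_h'])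
    have "smooth_on U (\<lambda>u. h' u $ i * h' u $ i)"
      by (rule smooth_on_bilinear[OF bounded_bilinear_mult open_U hi hi])
    then show "smooth_on U (\<lambda>u. f' u (axis i 1))"
      using smooth_on_cong[OF open_U, of "\<lambda>u. f' u (axis i 1)" "\<lambda>u. h' u $ i * h' u $ i"] val
      by (simp add: power2_eq_square)
  qed
  then have "egoroff_potential_on U h' \<phi>'"
    using partial_eqI[OF d] val by (simp add: egoroff_potential_on_def)
  then show ?thesis by blast
qed

text \<open>The dressed frame at \<open>\<lambda> = 0\<close>.  The dressing factor becomes there the reflection
  \<open>I - 2 Q\<close>, so the new frame is again orthogonal.\<close>

definition frame' :: "real^'n \<Rightarrow> real^'n^'n" where "frame' u = G 0 u ** (mat 1 - 2 *\<^sub>R Q u)"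

lemma frame'_has_derivative:
  assumes u: "u \<in> U"
  shows "(frame' has_derivative (\<lambda>v. frame' u ** mcomm (diag_mat v) (\<beta>' u))) (at u)"
proof -
  define D B r g where "D v = diag_mat v" and "B = \<beta> u" and "r = Q u" and "g = G 0 u" for v :: "real^'n"
  have r: "r ** r = r" "r ** (r ** X) = r ** X" for X :: "real^'n^'n"
    using projection(1)[OF u] by (simp_all add: r_def matrix_mul_assoc)
  show ?thesis
    unfolding frame'_def[abs_def]
    by (rule has_derivative_eq_rhs,
        rule matrix_mult_has_derivative[OF frame_has_derivative[OF u]
          has_derivative_diff[OF has_derivative_const has_derivative_scaleR_right[OF projection_has_derivative[OF u]]]])
      (simp add: fun_eq_iff mcomm_def \<beta>'_def r matrix_ring_simps flip: D_def B_def r_def g_def,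
       simp add: vec_eq_iff algebra_simps)
qed

lemma frame'_orthogonal:
  assumes u: "u \<in> U"
  shows "transpose (frame' u) ** frame' u = mat 1"
proof -
  let ?R = "mat 1 - 2 *\<^sub>R Q u"
  have "transpose (frame' u) ** frame' u = transpose ?R ** ((transpose (G 0 u) ** G 0 u) ** ?R)"
    by (simp add: frame'_def matrix_transpose_mul matrix_mul_assoc)
  also have "\<dots> = ?R ** ?R"
    using frame_inverse(2)[OF u, of 0] by (simp add: transpose_linear_simps projection[OF u])
  also have "\<dots> = mat 1"
    by (simp add: matrix_ring_simps projection[OF u]) (simp add: vec_eq_iff)
  finally show ?thesis .
qed

text \<open>The columns of \<open>frame'\<close> scaled by \<open>h'\<close> form a closed frame: for \<open>i \<noteq> j\<close> the derivative
  \<open>\<partial>\<^sub>i (h'\<^sub>j e\<^sub>j)\<close> equals \<open>\<beta>'\<^sub>i\<^sub>j (h'\<^sub>j e\<^sub>i + h'\<^sub>i e\<^sub>j)\<close>, where \<open>e\<^sub>i\<close> denotes the \<open>i\<close>-th column, and \<open>\<beta>'\<close> is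
  symmetric.  The dual frame is obtained by scaling with \<open>1 / h'\<close>.\<close>

lemma flat_egoroff':
  defines "V \<equiv> {u \<in> U. \<forall>j. h' u $ j \<noteq> 0}"
  shows "open V" "flat_egoroff_on V h'"
    "\<And>u i j. u \<in> V \<Longrightarrow> rotation_coeffs h' u $ i $ j = (if i = j then 0 else \<beta>' u $ i $ j)"
proof -
  have VU: "V \<subseteq> U" by (auto simp: V_def)
  have "continuous_on U h'" using smooth_h' unfolding smooth_on_def by (metis Ck_on.simps(1))
  then have "open (U \<inter> (\<lambda>u. h' u $ j) -` (- {0}))" for j
    by (intro continuous_open_preimage continuous_on_component open_U open_Compl) auto
  moreover have "{u \<in> U. h' u $ j \<noteq> 0} = U \<inter> (\<lambda>u. h' u $ j) -` (- {0})" for j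
    by auto
  ultimately have "open {u \<in> U. h' u $ j \<noteq> 0}" for j by simp
  then have "open (\<Inter>j. {u \<in> U. h' u $ j \<noteq> 0})" by (intro open_INT) auto
  moreover have "V = (\<Inter>j. {u \<in> U. h' u $ j \<noteq> 0})" by (auto simp: V_def)
  ultimately show V: "open V" by simp
  have smooth_frame': "smooth_on U frame'"
    unfolding smooth_on_def frame'_def[abs_def]
    by (intro allI Ck_on_intros(6) Ck_on_diff Ck_on_scaleR_const Ck_on_const open_U
        frame_Ck_on[OF smooth_\<beta>] solution_Ck_on[THEN conjunct1])
  have hi: "smooth_on V (\<lambda>u. h' u $ i)" for i
    by (rule smooth_on_subset[OF smooth_on_bounded_linear[OF bounded_linear_vec_nth open_U smooth_h'] VU])
  have frame'_axis: "smooth_on V (\<lambda>u. frame' u *v axis i 1)" for i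
    by (rule smooth_on_bilinear[OF bounded_bilinear_matrix_vector_mult V smooth_on_subset[OF smooth_frame' VU] smooth_on_const])
  have orth: "(frame' u *v axis i 1) \<bullet> (frame' u *v axis j 1) = (if i = j then 1 else 0)" if "u \<in> V" for u i j
  proof -
    have "(frame' u *v axis i 1) \<bullet> (frame' u *v axis j 1) = (transpose (frame' u) *v (frame' u *v axis i 1)) \<bullet> axis j 1"
      by (simp add: inner_transpose_matrix)
    also have "\<dots> = axis i 1 \<bullet> axis j (1 :: real)"
      using frame'_orthogonal[of u] VU that by (auto simp only: matrix_vector_mul_assoc matrix_vector_mul_lid)
    finally show ?thesis by (simp add: inner_axis_axis)
  qed
  define T where "T j u = h' u $ j *\<^sub>R (frame' u *v axis j 1)" for j u
  define S where "S j u = inverse (h' u $ j) *\<^sub>R (frame' u *v axis j 1)" for j u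
  have T: "smooth_on V (T j)" for j
    unfolding T_def by (rule smooth_on_bilinear[OF bounded_bilinear_scaleR V hi frame'_axis])
  have S: "smooth_on V (S j)" for j
    unfolding S_def
    by (rule smooth_on_bilinear[OF bounded_bilinear_scaleR V smooth_on_inverse[OF V hi] frame'_axis])
      (simp add: V_def)
  have dT: "partial i (T j) u = (h' u $ j * \<beta>' u $ i $ j) *\<^sub>R (frame' u *v axis i 1)
      + (\<beta>' u $ j $ i * h' u $ i) *\<^sub>R (frame' u *v axis j 1)" if u: "u \<in> V" and "i \<noteq> j" for u i j
  proof -
    have uU: "u \<in> U" using u VU by blast
    have "(T j has_derivative (\<lambda>v. h' u $ j *\<^sub>R ((frame' u ** mcomm (diag_mat v) (\<beta>' u)) *v axis j 1)
        + frechet_derivative (\<lambda>x. h' x $ j) (at u) v *\<^sub>R (frame' u *v axis j 1))) (at u)"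
      unfolding T_def
      by (rule has_derivative_eq_rhs,
          rule has_derivative_scaleR[OF smooth_on_has_derivative[OF V hi u]
            matrix_vector_has_derivative[OF frame'_has_derivative[OF uU] has_derivative_const]])
        (simp add: matrix_vector_linear_simps)
    from partial_eqI[OF this, of i]
    show ?thesis
      using rotation'[OF uU, of j i] \<open>i \<noteq> j\<close>
      by (simp add: partial_def mcomm_axis_mult_axis matrix_vector_linear_simps
          flip: matrix_vector_mul_assoc)
  qed
  have closed: "partial i (T j) u = partial j (T i) u" if u: "u \<in> V" for u i j
  proof (cases "i = j")
    case False
    have "\<beta>' u $ i $ j = \<beta>' u $ j $ i"
      using arg_cong[OF \<beta>'_sym, of u "\<lambda>M. M $ i $ j"] u VU by (auto simp: transpose_def)
    then show ?thesis using False u by (simp add: dT mult.commute)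
  qed simp
  have g: "diag_metric h' u = (\<chi> i j. T i u \<bullet> T j u)" if "u \<in> V" for u
    using orth[OF that] by (simp add: vec_eq_iff diag_metric_def diag_mat_def T_def power2_eq_square)
  have dual: "T i u \<bullet> S j u = (if i = j then 1 else 0)" if "u \<in> V" for i j u
    using orth[OF that] that by (auto simp: T_def S_def V_def)
  have "flat_metric_on V (diag_metric h')"
    unfolding flat_metric_on_def
  proof (intro conjI ballI allI impI)
    show "smooth_on V (diag_metric h')"
    proof (intro smooth_on_vec V)
      fix i j
      have "smooth_on V (\<lambda>u. h' u $ i * h' u $ i)"
        by (rule smooth_on_bilinear[OF bounded_bilinear_mult V hi hi])
      then show "smooth_on V (\<lambda>u. diag_metric h' u $ i $ j)"
        by (cases "i = j") (simp_all add: diag_metric_def diag_mat_def power2_eq_square smooth_on_const)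
    qed
    fix u assume u: "u \<in> V"
    show "transpose (diag_metric h' u) = diag_metric h' u"
      by (simp add: diag_metric_def transpose_diag_mat)
    show "riemann (diag_metric h') l k i j u = 0" for l k i j
      by (rule riemann_eq_0_of_closed_frame[OF V T S dual closed g u])
    fix v :: "real^'n" assume "v \<noteq> 0"
    then obtain m where m: "v $ m \<noteq> 0" by (auto simp: vec_eq_iff)
    have "v \<bullet> (diag_metric h' u *v v) = (\<Sum>i\<in>UNIV. (h' u $ i * v $ i)\<^sup>2)"
      by (simp add: diag_metric_def inner_vec_def diag_mat_mult_nth power2_eq_square mult_ac)
    also have "\<dots> > 0"
      by (rule sum_pos2[of _ m]) (use m u in \<open>auto simp: V_def\<close>)
    finally show "v \<bullet> (diag_metric h' u *v v) > 0" .
  qed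
  moreover obtain \<phi>' where "egoroff_potential_on U h' \<phi>'" using potential' by blast
  then have "egoroff_potential_on V h' \<phi>'"
    using smooth_on_subset[OF _ VU] VU unfolding egoroff_potential_on_def by blast
  ultimately show "flat_egoroff_on V h'"
    unfolding flat_egoroff_on_def using smooth_on_subset[OF smooth_h' VU] by (auto simp: V_def)
  show "rotation_coeffs h' u $ i $ j = (if i = j then 0 else \<beta>' u $ i $ j)" if "u \<in> V" for u i j
    using rotation'[of u i j] that by (auto simp: rotation_coeffs_def V_def)
qed

end

section \<open>From complex to real frames\<close>

definition remat :: "complex^'n^'n \<Rightarrow> real^'n^'n" where
  "remat A = map_matrix Re A"

lemma remat_nth [simp]: "remat A $ i $ j = Re (A $ i $ j)"
  by (simp add: remat_def)

lemma cmat_nth [simp]: "cmat A $ i $ j = complex_of_real (A $ i $ j)"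
  by (simp add: cmat_def)

lemma cvec_nth [simp]: "cvec v $ i = complex_of_real (v $ i)"
  by (simp add: cvec_def)

lemma cmat_eqI:
  assumes "map_matrix cnj A = A"
  shows "cmat (remat A) = A"
  using assms by (auto simp: vec_eq_iff complex_eq_iff)

lemma remat_cmat [simp]: "remat (cmat A) = A"
  by (simp add: vec_eq_iff)

lemma cmat_inj [simp]: "cmat A = cmat B \<longleftrightarrow> A = B"
  by (metis remat_cmat)

lemma cnj_cmat: "map_matrix cnj (cmat A) = cmat A"
  by (simp add: vec_eq_iff)

lemma cmat_simps:
  "cmat (A ** B) = cmat A ** cmat B" "cmat (A + B) = cmat A + cmat B" "cmat (A - B) = cmat A - cmat B"
  "cmat (- A) = - cmat A" "cmat (c *\<^sub>R A) = c *\<^sub>R cmat A" "cmat (mat 1) = mat 1"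
  "cmat (transpose A) = transpose (cmat A)"
  by (simp_all add: vec_eq_iff complex_eq_iff matrix_matrix_mult_def mat_def transpose_def)

lemma cvec_simps:
  "cvec (A *v v) = cmat A *v cvec v" "cvec (v + w) = cvec v + cvec w" "cvec (v - w) = cvec v - cvec w"
  "cvec (- v) = - cvec v" "cvec (c *\<^sub>R v) = c *\<^sub>R cvec v"
  by (simp_all add: vec_eq_iff complex_eq_iff matrix_vector_mult_def)

lemma delta_eq_cmat: "delta v = cmat (diag_mat v)"
  by (simp add: delta_def diag_mat_def vec_eq_iff)

lemma commutator_cmat: "commutator (cmat A) (cmat B) = cmat (mcomm A B)"
  by (simp add: commutator_def mcomm_def cmat_simps)

lemma remat_mult_cmat: "remat (A ** cmat B) = remat A ** B"
  by (simp add: vec_eq_iff matrix_matrix_mult_def)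

lemma bounded_linear_cmat: "bounded_linear (cmat :: real^'n^'n \<Rightarrow> _)"
  unfolding linear_conv_bounded_linear[symmetric] by (auto intro!: linearI simp: cmat_simps)

lemma bounded_linear_cvec: "bounded_linear (cvec :: real^'n \<Rightarrow> _)"
  unfolding linear_conv_bounded_linear[symmetric] by (auto intro!: linearI simp: cvec_simps)

lemma bounded_linear_remat: "bounded_linear (remat :: complex^'n^'n \<Rightarrow> _)"
  unfolding linear_conv_bounded_linear[symmetric] by (auto intro!: linearI simp: vec_eq_iff)

definition revec :: "complex^'n \<Rightarrow> real^'n" where
  "revec v = (\<chi> i. Re (v $ i))"

lemma revec_cvec [simp]: "revec (cvec v) = v"
  by (simp add: revec_def vec_eq_iff)

lemma bounded_linear_revec: "bounded_linear (revec :: complex^'n \<Rightarrow> _)"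
  unfolding linear_conv_bounded_linear[symmetric] by (auto intro!: linearI simp: vec_eq_iff revec_def)

lemma revec_mult_cvec: "revec (A *v cvec v) = remat A *v v"
  by (simp add: vec_eq_iff revec_def matrix_vector_mult_def)

lemma hermitian_projection_cmat:
  "hermitian_projection (cmat q) \<longleftrightarrow> q ** q = q \<and> transpose q = q"
  by (simp add: hermitian_projection_def cnj_cmat flip: cmat_simps)

lemma transformation_system_cmat:
  assumes "0 \<in> U"
  shows "transformation_system U h \<beta> a (cmat \<pi>0) b (\<lambda>u. cmat (Q u)) y \<longleftrightarrow> real_system U h \<beta> a \<pi>0 b Q y"
proof -
  have eqQ: "((\<lambda>u. cmat (Q u)) has_derivative (\<lambda>v. cmat (q v))) (at u) \<longleftrightarrow> (Q has_derivative q) (at u)" for q u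
    using bounded_linear.has_derivative[OF bounded_linear_remat, of "\<lambda>u. cmat (Q u)" "\<lambda>v. cmat (q v)" "at u"]
      bounded_linear.has_derivative[OF bounded_linear_cmat, of Q q "at u"] by auto
  have eqy: "((\<lambda>u. cvec (y u)) has_derivative (\<lambda>v. cvec (q v))) (at u) \<longleftrightarrow> (y has_derivative q) (at u)" for q u
    using bounded_linear.has_derivative[OF bounded_linear_revec, of "\<lambda>u. cvec (y u)" "\<lambda>v. cvec (q v)" "at u"]
      bounded_linear.has_derivative[OF bounded_linear_cvec, of y q "at u"] by auto
  show ?thesis
    unfolding transformation_system_def real_system_def eqQ[symmetric] eqy[symmetric]
    by (simp only: cmat_simps cvec_simps delta_eq_cmat commutator_cmat[symmetric] hermitian_projection_cmat
        cnj_cmat cmat_inj simp_thms)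
qed

text \<open>A projection that is fixed by conjugation has real entries, so every solution of the complex
  system comes from a real one.  The identity \<open>P = cmat (remat P)\<close> is available on \<open>U\<close> only, hence
  derivatives are transferred on the open set \<open>U\<close>.\<close>

lemma transformation_system_real:
  assumes "open U" "0 \<in> U" and sys: "transformation_system U h \<beta> a \<pi>0 b P y"
  shows "real_system U h \<beta> a (remat \<pi>0) b (\<lambda>u. remat (P u)) y"
    and "\<And>u. u \<in> U \<Longrightarrow> P u = cmat (remat (P u))"
proof -
  show P: "P u = cmat (remat (P u))" if "u \<in> U" for u
    using sys that by (simp add: transformation_system_def cmat_eqI)
  have "P 0 = \<pi>0" using sys by (simp add: transformation_system_def)
  then have \<pi>0: "cmat (remat \<pi>0) = \<pi>0" using P[OF assms(2)] by metis
  have "transformation_system U h \<beta> a (cmat (remat \<pi>0)) b (\<lambda>u. cmat (remat (P u))) y"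
    unfolding transformation_system_def
  proof (intro conjI ballI)
    fix u assume u: "u \<in> U"
    note s = sys[unfolded transformation_system_def]
    show "((\<lambda>u. cmat (remat (P u))) has_derivative (\<lambda>v.
          - (commutator (commutator (delta v) (cmat (\<beta> u))) (cmat (remat (P u)))
             + a *\<^sub>R (commutator (delta v) (cmat (remat (P u))) ** (mat 1 - 2 *\<^sub>R cmat (remat (P u))))))) (at u)"
      unfolding P[OF u, symmetric]
      by (rule has_derivative_transform_within_open[OF bspec[OF conjunct1[OF s] u] assms(1) u])
        (rule P)
    show "((\<lambda>x. cvec (y x)) has_derivative (\<lambda>v.
          - (commutator (delta v) (cmat (\<beta> u) - (2 * a) *\<^sub>R cmat (remat (P u))) *v cvec (y u))
          + cmat (remat (P u)) *v (delta v *v cvec (h u))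
          - a *\<^sub>R (delta v *v cvec (y u)))) (at u)"
      "hermitian_projection (cmat (remat (P u)))"
      "map_matrix cnj (cmat (remat (P u))) = cmat (remat (P u))"
      using s u unfolding P[OF u, symmetric] by blast+
  qed (use sys in \<open>simp_all add: transformation_system_def\<close>)
  then show "real_system U h \<beta> a (remat \<pi>0) b (\<lambda>u. remat (P u)) y"
    by (simp add: transformation_system_cmat[OF assms(2)])
qed

lemma bordered_mult:
  "bordered A x 1 ** bordered B y 0 = bordered (A ** B) (A *v y) 0"
proof -
  have "(bordered A x 1 ** bordered B y 0) $ r $ s = bordered (A ** B) (A *v y) 0 $ r $ s" for r s
    by (cases r; cases s)
      (simp_all add: bordered_def matrix_matrix_mult_def matrix_vector_mult_def UNIV_option_conv
        sum.reindex)
  then show ?thesis by (simp add: vec_eq_iff)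
qed

definition border_block :: "complex^('n option)^('n option) \<Rightarrow> complex^'n^'n" where
  "border_block M = (\<chi> i j. M $ Some i $ Some j)"

definition border_column :: "complex^('n option)^('n option) \<Rightarrow> complex^'n" where
  "border_column M = (\<chi> i. M $ Some i $ None)"

lemma border_simps [simp]:
  "border_block (bordered A x c) = A" "border_column (bordered A x c) = x"
  by (simp_all add: border_block_def border_column_def bordered_def vec_eq_iff)

lemma bounded_linear_border:
  "bounded_linear (border_block :: complex^('n::finite option)^('n option) \<Rightarrow> _)"
  "bounded_linear (border_column :: complex^('n::finite option)^('n option) \<Rightarrow> _)"
  unfolding linear_conv_bounded_linear[symmetric]
  by (auto intro!: linearI simp: vec_eq_iff border_block_def border_column_def)

lemma lax_form_imaginary:
  fixes h :: "real^'n \<Rightarrow> real^'n"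
  shows "lax_form h \<beta> (- (\<i> * complex_of_real s)) u v
    = bordered (cmat (s *\<^sub>R diag_mat v + mcomm (diag_mat v) (\<beta> u))) (cvec (diag_mat v *v h u)) 0"
proof -
  have "mat (complex_of_real s) ** cmat A = s *\<^sub>R cmat A" for A :: "real^'n^'n"
  proof -
    have "mat (complex_of_real s) = cmat (s *\<^sub>R mat 1 :: real^'n^'n)"
      by (simp add: vec_eq_iff mat_def)
    then show ?thesis
      by (simp only: cmat_simps(1)[symmetric] cmat_simps(5)[symmetric] matrix_mult_linear_simps matrix_mul_lid)
  qed
  then show ?thesis
    by (simp add: lax_form_def delta_eq_cmat commutator_cmat cmat_simps cvec_simps mult.assoc[symmetric])
qed

text \<open>The real parts of the blocks of the frame at \<open>\<lambda> = - \<i> s\<close> satisfy the same equation with the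
  same initial value, because its coefficients are real.\<close>

lemma associated_family_real_frames:
  assumes "open U" "connected U" "0 \<in> U" "\<And>u. u \<in> U \<Longrightarrow> transpose (\<beta> u) = \<beta> u"
    and "associated_family U h \<beta> X"
  shows "\<exists>G x. lax_frames U h \<beta> G x"
proof -
  obtain E where E0: "\<And>l. bordered (E l 0) (X l 0) 1 = mat 1"
    and dE: "\<And>l u. u \<in> U \<Longrightarrow> ((\<lambda>x. bordered (E l x) (X l x) 1) has_derivative
               (\<lambda>v. bordered (E l u) (X l u) 1 ** lax_form h \<beta> l u v)) (at u)"
    using assms(5) unfolding associated_family_def by blast
  define l where "l s = - (\<i> * complex_of_real s)" for s
  have d: "((\<lambda>x. bordered (E (l s) x) (X (l s) x) 1) has_derivative
      (\<lambda>v. bordered (E (l s) u ** cmat (s *\<^sub>R diag_mat v + mcomm (diag_mat v) (\<beta> u)))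
        (E (l s) u *v cvec (diag_mat v *v h u)) 0)) (at u)" if "u \<in> U" for s u
    using dE[OF that, of "l s"] by (simp add: l_def lax_form_imaginary bordered_mult)
  have "lax_frames U h \<beta> (\<lambda>s u. remat (E (l s) u)) (\<lambda>s u. revec (X (l s) u))"
  proof
    show "((\<lambda>u. remat (E (l s) u)) has_derivative
        (\<lambda>v. remat (E (l s) u) ** (s *\<^sub>R diag_mat v + mcomm (diag_mat v) (\<beta> u)))) (at u)" if "u \<in> U" for s u
      using bounded_linear.has_derivative[OF bounded_linear_compose[OF bounded_linear_remat bounded_linear_border(1)] d[OF that, of s]]
      by (simp add: remat_mult_cmat)
    show "((\<lambda>u. revec (X (l s) u)) has_derivative (\<lambda>v. remat (E (l s) u) *v (diag_mat v *v h u))) (at u)"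
      if "u \<in> U" for s u
      using bounded_linear.has_derivative[OF bounded_linear_compose[OF bounded_linear_revec bounded_linear_border(2)] d[OF that, of s]]
      by (simp add: revec_mult_cvec)
    show "remat (E (l s) 0) = mat 1" for s
      using arg_cong[OF E0[of "l s"], of border_block]
      by (simp add: vec_eq_iff border_block_def mat_def bordered_def)
    show "revec (X (l s) 0) = 0" for s
      using arg_cong[OF E0[of "l s"], of border_column]
      by (simp add: vec_eq_iff border_column_def mat_def bordered_def revec_def)
  qed (use assms in auto)
  then show ?thesis by blast
qed

text \<open>The mixed second derivative \<open>\<partial>\<^sub>j \<partial>\<^sub>i \<phi> = \<partial>\<^sub>j (h\<^sub>i\<^sup>2) = 2 h\<^sub>i \<beta>\<^sub>i\<^sub>j h\<^sub>j\<close> is symmetric in \<open>i\<close> and \<open>j\<close>,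
  and \<open>h\<close> has no zeros.\<close>

lemma egoroff_rotation_coeffs:
  assumes "open U" "smooth_on U h" "\<And>u i. u \<in> U \<Longrightarrow> h u $ i \<noteq> 0" "egoroff_potential_on U h \<phi>"
    and \<beta>: "\<And>u. u \<in> U \<Longrightarrow> \<beta> u = rotation_coeffs h u"
  shows "u \<in> U \<Longrightarrow> transpose (\<beta> u) = \<beta> u" and "smooth_on U \<beta>"
    and "u \<in> U \<Longrightarrow> i \<noteq> j \<Longrightarrow> partial j (\<lambda>x. h x $ i) u = \<beta> u $ i $ j * h u $ j"
proof -
  have hi: "smooth_on U (\<lambda>x. h x $ i)" for i
    by (rule smooth_on_bounded_linear[OF bounded_linear_vec_nth assms(1,2)])
  show rot: "partial j (\<lambda>x. h x $ i) u = \<beta> u $ i $ j * h u $ j" if "u \<in> U" "i \<noteq> j" for u i j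
    using that assms(3) by (simp add: \<beta> rotation_coeffs_def)
  show "transpose (\<beta> u) = \<beta> u" if u: "u \<in> U" for u
  proof -
    have "\<beta> u $ i $ j = \<beta> u $ j $ i" if "i \<noteq> j" for i j
    proof -
      have second: "partial j (partial i \<phi>) u = 2 * (h u $ i * \<beta> u $ i $ j * h u $ j)" if "i \<noteq> j" for i j
      proof -
        have "partial j (partial i \<phi>) u = partial j (\<lambda>x. h x $ i \<bullet> h x $ i) u"
          by (rule partial_cong_open[OF assms(1) u])
            (use assms(4) in \<open>simp add: egoroff_potential_on_def power2_eq_square\<close>)
        then show ?thesis
          by (simp only: partial_inner[OF assms(1) hi hi u] rot[OF u that]) simp
      qed
      have "2 * (h u $ i * \<beta> u $ i $ j * h u $ j) = 2 * (h u $ j * \<beta> u $ j $ i * h u $ i)"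
        using second[OF that] second[OF that[symmetric]] partial_commute[OF assms(1) _ u, of \<phi> j i] assms(4)
        by (simp add: egoroff_potential_on_def)
      then show ?thesis using assms(3)[OF u] by simp
    qed
    then show ?thesis by (simp add: vec_eq_iff transpose_def) metis
  qed
  have "smooth_on U (\<lambda>u. rotation_coeffs h u $ i $ j)" for i j
  proof (cases "i = j")
    case False
    have "smooth_on U (\<lambda>u. partial j (\<lambda>x. h x $ i) u * inverse (h u $ j))"
      by (rule smooth_on_bilinear[OF bounded_bilinear_mult assms(1) smooth_on_partial[OF hi]
            smooth_on_inverse[OF assms(1) hi assms(3)]])
    then show ?thesis using False by (simp add: rotation_coeffs_def divide_inverse)
  qed (simp add: rotation_coeffs_def smooth_on_const)
  then have "smooth_on U (rotation_coeffs h)"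
    by (intro smooth_on_vec assms(1))
  then show "smooth_on U \<beta>" using smooth_on_cong[OF assms(1), of \<beta> "rotation_coeffs h"] \<beta> by blast
qed

theorem theorem5p6:
  fixes U :: "(real^'n) set"
    and h :: "real^'n \<Rightarrow> real^'n"
    and \<beta> :: "real^'n \<Rightarrow> real^'n^'n"
    and X :: "complex \<Rightarrow> real^'n \<Rightarrow> complex^'n"
    and \<alpha> :: real
    and \<pi>0 :: "complex^'n^'n"
    and b :: "real^'n"
  assumes "open U" and "simply_connected U" and "0 \<in> U"
    and "flat_egoroff_on U h"
    and "\<forall>u\<in>U. \<beta> u = rotation_coeffs h u"
    and "associated_family U h \<beta> X"
    and "\<forall>r::real. r \<noteq> 0 \<longrightarrow>
           lagrangian_immersion_on U (X (complex_of_real r))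
         \<and> (\<forall>u\<in>U. induced_metric (X (complex_of_real r)) u = diag_metric h u)
         \<and> nondegenerate_normal_bundle_on U (X (complex_of_real r))"
    and "\<alpha> \<noteq> 0"
    and "hermitian_projection \<pi>0" and "map_matrix cnj \<pi>0 = \<pi>0"
  shows "(\<exists>P y. transformation_system U h \<beta> \<alpha> \<pi>0 b P y)
    \<and> (\<forall>P y. transformation_system U h \<beta> \<alpha> \<pi>0 b P y \<longrightarrow>
         (let h' = (\<lambda>u. h u - (2 * \<alpha>) *\<^sub>R y u);
              \<beta>' = (\<lambda>u. cmat (\<beta> u) - (2 * \<alpha>) *\<^sub>R offdiag (P u));
              V = {u \<in> U. \<forall>j. h' u $ j \<noteq> 0}
          in open V
           \<and> flat_egoroff_on V h'
           \<and> (\<forall>u\<in>V. cmat (rotation_coeffs h' u) = \<beta>' u)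
           \<and> smooth_on U h'
           \<and> (\<exists>\<phi>. egoroff_potential_on U h' \<phi>)
           \<and> (\<forall>u\<in>U. \<forall>i j. i \<noteq> j \<longrightarrow>
                complex_of_real (partial j (\<lambda>x. h' x $ i) u)
                  = \<beta>' u $ i $ j * complex_of_real (h' u $ j))))"
proof -
  obtain \<phi> where \<phi>: "egoroff_potential_on U h \<phi>" and h: "smooth_on U h" "\<And>u i. u \<in> U \<Longrightarrow> h u $ i \<noteq> 0"
    using assms(4) unfolding flat_egoroff_on_def by blast
  note \<beta> = egoroff_rotation_coeffs[OF assms(1) h \<phi> bspec[OF assms(5)]]
  obtain G x where "lax_frames U h \<beta> G x"
    using associated_family_real_frames[OF assms(1) simply_connected_imp_connected[OF assms(2)]
        assms(3) \<beta>(1) assms(6)] by blast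
  then interpret lax_frames U h \<beta> G x .
  define p where "p = remat \<pi>0"
  have p: "cmat p = \<pi>0" by (simp add: p_def cmat_eqI assms)
  have "p ** p = p" "transpose p = p"
    using assms(9) hermitian_projection_cmat[of p] by (simp_all add: p)
  from real_system_solvable[OF this, of \<alpha> b]
  have "\<exists>P y. transformation_system U h \<beta> \<alpha> \<pi>0 b P y"
    unfolding p[symmetric] using transformation_system_cmat[OF assms(3)] by blast
  moreover have "let h' = (\<lambda>u. h u - (2 * \<alpha>) *\<^sub>R y u);
              \<beta>' = (\<lambda>u. cmat (\<beta> u) - (2 * \<alpha>) *\<^sub>R offdiag (P u));
              V = {u \<in> U. \<forall>j. h' u $ j \<noteq> 0}
          in open V
           \<and> flat_egoroff_on V h'
           \<and> (\<forall>u\<in>V. cmat (rotation_coeffs h' u) = \<beta>' u)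
           \<and> smooth_on U h'
           \<and> (\<exists>\<phi>. egoroff_potential_on U h' \<phi>)
           \<and> (\<forall>u\<in>U. \<forall>i j. i \<noteq> j \<longrightarrow>
                complex_of_real (partial j (\<lambda>x. h' x $ i) u)
                  = \<beta>' u $ i $ j * complex_of_real (h' u $ j))"
    if sys: "transformation_system U h \<beta> \<alpha> \<pi>0 b P y" for P y
  proof -
    define Q where "Q u = remat (P u)" for u
    note real = transformation_system_real[OF assms(1,3) sys, folded Q_def p_def]
    interpret t: transformed_egoroff U h \<beta> G x \<phi> \<alpha> p b Q y
      by unfold_locales (use h \<beta> \<phi> real in \<open>auto simp: Q_def[abs_def]\<close>)
    have h': "(\<lambda>u. h u - (2 * \<alpha>) *\<^sub>R y u) = t.h'"
      by (simp add: fun_eq_iff t.h'_def)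
    have \<beta>': "(cmat (\<beta> u) - (2 * \<alpha>) *\<^sub>R offdiag (P u)) $ i $ j
        = complex_of_real (if i = j then \<beta> u $ i $ i else t.\<beta>' u $ i $ j)" if "u \<in> U" for u i j
      using real(2)[OF that] by (simp add: offdiag_def t.\<beta>'_def complex_eq_iff)
    have diag: "\<beta> u $ i $ i = 0" if "u \<in> U" for u i
      using assms(5) that by (simp add: rotation_coeffs_def)
    show ?thesis
      unfolding h' Let_def
      using t.flat_egoroff' t.smooth_h' t.potential' t.rotation'
      by (auto simp: vec_eq_iff \<beta>' diag simp del: vector_minus_component vector_scaleR_component)
  qed
  ultimately show ?thesis by blast
qed

end
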